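(* Let $K$ be a field with $\operatorname{char} K\neq 3$ containing a primitive cube root of unity $\xi$, let $a,b\in K^{*}$, and let $S=\left(\frac{a,b}{K,\xi}\right)$ be the symbol algebra of degree $3$. Let $\tau$ and $\pi$ be the linear and quadratic coefficient forms of the characteristic polynomial on $S$, and let $\widetilde{S}=\{z\in S : \tau(z)=0\}$. On the vector space $\widetilde{S}$ define $$z\circ w=\xi zw-\xi^{2}wz-\frac{2\xi+1}{3}\,\tau(zw)\cdot 1,\qquad z,w\in\widetilde{S}.$$ Let $u\in\widetilde{S}$ be an element with $\pi(u)\neq 0$, put $v=\frac{1}{\pi(u)}\,(u\circ u)\in\widetilde{S}$, let $R_v^{\circ},L_v^{\circ}:\widetilde{S}\to\widetilde{S}$ be the (bijective) linear maps $R_v^{\circ}(x)=x\circ v$ and $L_v^{\circ}(x)=v\circ x$, and define $$z\bigtriangledown w=\big((R_v^{\circ})^{-1}(z)\big)\circ\big((L_v^{\circ})^{-1}(w)\big),\qquad z,w\in\widetilde{S}.$$ Then $(\widetilde{S},\bigtriangledown)$ is an octonion algebra over $K$ which is not a division algebra.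
   Context: The symbol algebra $\left(\frac{a,b}{K,\xi}\right)$ of degree $n$ (here $n=3$), where $\xi\in K$ is a primitive $n$-th root of unity, $\operatorname{char}K\nmid n$ and $a,b\in K^*$, is the associative unital $K$-algebra generated by $x,y$ with relations $x^n=a$, $y^n=b$, $yx=\xi xy$; it is central simple of dimension $n^2$ over $K$. For $z\in S$ (degree $3$), the (reduced) characteristic polynomial of $z$ is written $P(X,z)=X^3-\tau(z)X^2+\pi(z)X-\eta(z)\cdot 1$, where $\tau$ is a linear form, $\pi$ a quadratic form and $\eta$ a cubic form on $S$. The form $\pi$ is nondegenerate on $\widetilde S$, so an element $u\in\widetilde S$ with $\pi(u)\ne 0$ exists. A Hurwitz algebra is a unital (not necessarily associative) $K$-algebra $A$ with a nondegenerate quadratic form $n$ satisfying $n(xy)=n(x)n(y)$ for all $x,y\in A$; an octonion algebra is a Hurwitz algebra of dimension $8$, and $n$ is called its norm. An octonion algebra with norm $n$ is a division algebra if $n(x)=0$ implies $x=0$. *)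

theory Defs
  imports
    "HOL-Library.Poly_Mapping"
    "HOL-Algebra.Algebraic_Closure_Type"
    "Jordan_Normal_Form.Char_Poly"
begin

section \<open>Unital associative algebras\<close>

text \<open>The underlying vector space of an algebra is a whole type \<open>'s\<close>; the scalar multiplication
  \<open>scale\<close>, the product \<open>mul\<close> and the unit \<open>e\<close> are terms, so that they may depend on parameters
  from the base field.\<close>

definition assoc_algebra ::
    "('k::field \<Rightarrow> 's::ab_group_add \<Rightarrow> 's) \<Rightarrow> ('s \<Rightarrow> 's \<Rightarrow> 's) \<Rightarrow> 's \<Rightarrow> bool" where
  "assoc_algebra scale mul e \<longleftrightarrow>
     vector_space scale \<and>
     (\<forall>z. Vector_Spaces.linear scale scale (\<lambda>w. mul z w)) \<and>
     (\<forall>w. Vector_Spaces.linear scale scale (\<lambda>z. mul z w)) \<and>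
     (\<forall>z w t. mul (mul z w) t = mul z (mul w t)) \<and>
     (\<forall>z. mul e z = z \<and> mul z e = z)"


section \<open>Symbol algebras\<close>

datatype letter = Letter_x | Letter_y

text \<open>The free monoid on two letters, written additively: the library's convolution ring
  \<open>'m \<Rightarrow>\<^sub>0 'k\<close> expects an additive monoid \<open>'m\<close>. Thus \<open>word \<Rightarrow>\<^sub>0 'k\<close> is the free associative
  unital \<open>'k\<close>-algebra on two (noncommuting) generators.\<close>

datatype word = Word (letters: "letter list")

instantiation word :: monoid_add
begin

definition zero_word :: word where "0 = Word []"

definition plus_word :: "word \<Rightarrow> word \<Rightarrow> word" where
  "u + v = Word (letters u @ letters v)"

instance
  by intro_classes (simp_all add: zero_word_def plus_word_def)

end

definition free_x :: "word \<Rightarrow>\<^sub>0 'k::field" where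
  "free_x = Poly_Mapping.single (Word [Letter_x]) 1"

definition free_y :: "word \<Rightarrow>\<^sub>0 'k::field" where
  "free_y = Poly_Mapping.single (Word [Letter_y]) 1"

definition free_const :: "'k::field \<Rightarrow> word \<Rightarrow>\<^sub>0 'k" where
  "free_const c = Poly_Mapping.single 0 c"

definition eval_word :: "('s \<Rightarrow> 's \<Rightarrow> 's) \<Rightarrow> 's \<Rightarrow> 's \<Rightarrow> 's \<Rightarrow> word \<Rightarrow> 's" where
  "eval_word mul e x y w =
     foldr (\<lambda>l r. mul (case l of Letter_x \<Rightarrow> x | Letter_y \<Rightarrow> y) r) (letters w) e"

definition eval_free ::
    "('k::field \<Rightarrow> 's::ab_group_add \<Rightarrow> 's) \<Rightarrow> ('s \<Rightarrow> 's \<Rightarrow> 's) \<Rightarrow> 's \<Rightarrow> 's \<Rightarrow> 's \<Rightarrow> (word \<Rightarrow>\<^sub>0 'k) \<Rightarrow> 's" where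
  "eval_free scale mul e x y p =
     (\<Sum>w\<in>Poly_Mapping.keys p. scale (Poly_Mapping.lookup p w) (eval_word mul e x y w))"

definition primitive_root_of_unity :: "nat \<Rightarrow> 'k::field \<Rightarrow> bool" where
  "primitive_root_of_unity n \<xi> \<longleftrightarrow> n > 0 \<and> \<xi> ^ n = 1 \<and> (\<forall>k. 0 < k \<and> k < n \<longrightarrow> \<xi> ^ k \<noteq> 1)"

text \<open>The algebra generated by \<open>x, y\<close> subject to \<open>x\<^sup>n = a\<close>, \<open>y\<^sup>n = b\<close>, \<open>yx = \<xi>xy\<close>: evaluation at
  \<open>x, y\<close> is onto, and its kernel is the two-sided ideal generated by the relators (the ideals of
  HOL-Algebra are two-sided). This determines the algebra up to isomorphism.\<close>

definition symbol_algebra ::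
    "('k::field \<Rightarrow> 's::ab_group_add \<Rightarrow> 's) \<Rightarrow> ('s \<Rightarrow> 's \<Rightarrow> 's) \<Rightarrow> 's \<Rightarrow> nat \<Rightarrow> 'k \<Rightarrow> 'k \<Rightarrow> 'k \<Rightarrow> bool" where
  "symbol_algebra scale mul e n \<xi> a b \<longleftrightarrow>
     primitive_root_of_unity n \<xi> \<and> \<not> CHAR('k) dvd n \<and> a \<noteq> 0 \<and> b \<noteq> 0 \<and>
     assoc_algebra scale mul e \<and>
     (\<exists>x y. surj (eval_free scale mul e x y) \<and>
        {p. eval_free scale mul e x y p = 0} =
          genideal ring_of_type_algebra
            {free_x ^ n - free_const a, free_y ^ n - free_const b,
             free_y * free_x - free_const \<xi> * free_x * free_y})"


section \<open>The reduced characteristic polynomial\<close>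

text \<open>\<open>K\<close>-algebra homomorphisms from the algebra to the \<open>n \<times> n\<close> matrices over the algebraic
  closure of \<open>K\<close>. They correspond to the homomorphisms of algebras over the algebraic closure from
  the scalar extension to the matrix algebra; for a central simple algebra of dimension \<open>n\<^sup>2\<close> the
  latter are exactly the isomorphisms, i.e. the splittings.\<close>

definition splitting_rep ::
    "nat \<Rightarrow> ('k::field \<Rightarrow> 's::ab_group_add \<Rightarrow> 's) \<Rightarrow> ('s \<Rightarrow> 's \<Rightarrow> 's) \<Rightarrow> 's \<Rightarrow>
     ('s \<Rightarrow> 'k alg_closure mat) \<Rightarrow> bool" where
  "splitting_rep n scale mul e \<phi> \<longleftrightarrow>
     (\<forall>z. \<phi> z \<in> carrier_mat n n) \<and>
     (\<forall>z w. \<phi> (z + w) = \<phi> z + \<phi> w) \<and>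
     (\<forall>c z. \<phi> (scale c z) = to_ac c \<cdot>\<^sub>m \<phi> z) \<and>
     (\<forall>z w. \<phi> (mul z w) = \<phi> z * \<phi> w) \<and>
     \<phi> e = 1\<^sub>m n"

definition reduced_char_poly ::
    "nat \<Rightarrow> ('k::field \<Rightarrow> 's::ab_group_add \<Rightarrow> 's) \<Rightarrow> ('s \<Rightarrow> 's \<Rightarrow> 's) \<Rightarrow> 's \<Rightarrow> 's \<Rightarrow> 'k poly" where
  "reduced_char_poly n scale mul e z =
     (THE P. \<forall>\<phi>. splitting_rep n scale mul e \<phi> \<longrightarrow> map_poly to_ac P = char_poly (\<phi> z))"

text \<open>In degree 3 the polynomial is \<open>X\<^sup>3 - \<tau>(z) X\<^sup>2 + \<pi>(z) X - \<eta>(z)\<close>.\<close>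

definition char_tau ::
    "('k::field \<Rightarrow> 's::ab_group_add \<Rightarrow> 's) \<Rightarrow> ('s \<Rightarrow> 's \<Rightarrow> 's) \<Rightarrow> 's \<Rightarrow> 's \<Rightarrow> 'k" where
  "char_tau scale mul e z = - poly.coeff (reduced_char_poly 3 scale mul e z) 2"

definition char_pi ::
    "('k::field \<Rightarrow> 's::ab_group_add \<Rightarrow> 's) \<Rightarrow> ('s \<Rightarrow> 's \<Rightarrow> 's) \<Rightarrow> 's \<Rightarrow> 's \<Rightarrow> 'k" where
  "char_pi scale mul e z = poly.coeff (reduced_char_poly 3 scale mul e z) 1"

definition tau_zero ::
    "('k::field \<Rightarrow> 's::ab_group_add \<Rightarrow> 's) \<Rightarrow> ('s \<Rightarrow> 's \<Rightarrow> 's) \<Rightarrow> 's \<Rightarrow> 's set" where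
  "tau_zero scale mul e = {z. char_tau scale mul e z = 0}"


section \<open>The two products on the trace zero space\<close>

definition circ ::
    "('k::field \<Rightarrow> 's::ab_group_add \<Rightarrow> 's) \<Rightarrow> ('s \<Rightarrow> 's \<Rightarrow> 's) \<Rightarrow> 's \<Rightarrow> 'k \<Rightarrow> 's \<Rightarrow> 's \<Rightarrow> 's" where
  "circ scale mul e \<xi> z w =
     scale \<xi> (mul z w) - scale (\<xi>\<^sup>2) (mul w z)
       - scale ((2 * \<xi> + 1) / 3 * char_tau scale mul e (mul z w)) e"

text \<open>The inverses are those of the maps restricted to the trace zero space.\<close>

definition nabla ::
    "('k::field \<Rightarrow> 's::ab_group_add \<Rightarrow> 's) \<Rightarrow> ('s \<Rightarrow> 's \<Rightarrow> 's) \<Rightarrow> 's \<Rightarrow> 'k \<Rightarrow> 's \<Rightarrow> 's \<Rightarrow> 's \<Rightarrow> 's" where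
  "nabla scale mul e \<xi> v z w =
     circ scale mul e \<xi>
       (inv_into (tau_zero scale mul e) (\<lambda>t. circ scale mul e \<xi> t v) z)
       (inv_into (tau_zero scale mul e) (\<lambda>t. circ scale mul e \<xi> v t) w)"


section \<open>Hurwitz and octonion algebras\<close>

text \<open>These are carried by a subspace \<open>V\<close>; nothing is required of products and norms outside \<open>V\<close>.\<close>

definition polar_form :: "('s::ab_group_add \<Rightarrow> 'k::field) \<Rightarrow> 's \<Rightarrow> 's \<Rightarrow> 'k" where
  "polar_form q z w = q (z + w) - q z - q w"

definition quadratic_form_on ::
    "('k::field \<Rightarrow> 's::ab_group_add \<Rightarrow> 's) \<Rightarrow> 's set \<Rightarrow> ('s \<Rightarrow> 'k) \<Rightarrow> bool" where
  "quadratic_form_on scale V q \<longleftrightarrow>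
     (\<forall>c. \<forall>z\<in>V. q (scale c z) = c\<^sup>2 * q z) \<and>
     (\<forall>z\<in>V. \<forall>w\<in>V. \<forall>t\<in>V. polar_form q (z + w) t = polar_form q z t + polar_form q w t) \<and>
     (\<forall>c. \<forall>z\<in>V. \<forall>t\<in>V. polar_form q (scale c z) t = c * polar_form q z t)"

text \<open>Nondegeneracy of a quadratic form means nondegeneracy of its polar form, in every
  characteristic.\<close>

definition nondegenerate_on :: "'s::ab_group_add set \<Rightarrow> ('s \<Rightarrow> 'k::field) \<Rightarrow> bool" where
  "nondegenerate_on V q \<longleftrightarrow> (\<forall>z\<in>V. (\<forall>w\<in>V. polar_form q z w = 0) \<longrightarrow> z = 0)"

definition algebra_on ::
    "('k::field \<Rightarrow> 's::ab_group_add \<Rightarrow> 's) \<Rightarrow> 's set \<Rightarrow> ('s \<Rightarrow> 's \<Rightarrow> 's) \<Rightarrow> bool" where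
  "algebra_on scale V prd \<longleftrightarrow>
     vector_space scale \<and> module.subspace scale V \<and>
     (\<forall>z\<in>V. \<forall>w\<in>V. prd z w \<in> V) \<and>
     (\<forall>z\<in>V. \<forall>w\<in>V. \<forall>t\<in>V. prd (z + w) t = prd z t + prd w t \<and> prd t (z + w) = prd t z + prd t w) \<and>
     (\<forall>c. \<forall>z\<in>V. \<forall>w\<in>V. prd (scale c z) w = scale c (prd z w) \<and> prd z (scale c w) = scale c (prd z w))"

definition hurwitz_algebra_on ::
    "('k::field \<Rightarrow> 's::ab_group_add \<Rightarrow> 's) \<Rightarrow> 's set \<Rightarrow> ('s \<Rightarrow> 's \<Rightarrow> 's) \<Rightarrow> ('s \<Rightarrow> 'k) \<Rightarrow> bool" where
  "hurwitz_algebra_on scale V prd q \<longleftrightarrow>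
     algebra_on scale V prd \<and>
     (\<exists>i\<in>V. \<forall>z\<in>V. prd i z = z \<and> prd z i = z) \<and>
     quadratic_form_on scale V q \<and> nondegenerate_on V q \<and>
     (\<forall>z\<in>V. \<forall>w\<in>V. q (prd z w) = q z * q w)"

definition octonion_algebra_on ::
    "('k::field \<Rightarrow> 's::ab_group_add \<Rightarrow> 's) \<Rightarrow> 's set \<Rightarrow> ('s \<Rightarrow> 's \<Rightarrow> 's) \<Rightarrow> ('s \<Rightarrow> 'k) \<Rightarrow> bool" where
  "octonion_algebra_on scale V prd q \<longleftrightarrow>
     hurwitz_algebra_on scale V prd q \<and> vector_space.dim scale V = 8"

text \<open>An octonion algebra on \<open>V\<close> with norm \<open>q\<close> is a division algebra iff \<open>q\<close> is anisotropic on \<open>V\<close>.\<close>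

definition division_norm_on :: "'s::ab_group_add set \<Rightarrow> ('s \<Rightarrow> 'k::field) \<Rightarrow> bool" where
  "division_norm_on V q \<longleftrightarrow> (\<forall>z\<in>V. q z = 0 \<longrightarrow> z = 0)"

end

theory Submission
  imports Defs
begin

text \<open>
On the trace zero space of a cubic symbol algebra, the product \<open>z \<circ> w\<close> and the form \<open>\<pi>\<close> make up a
symmetric composition algebra (an Okubo algebra): \<open>(z \<circ> w) \<circ> z = \<pi>(z) w = z \<circ> (w \<circ> z)\<close>. After
expansion these two identities are the polarized Cayley-Hamilton identity of a trace zero matrix
(\<open>circ_flexible_left\<close>, \<open>circ_flexible_right\<close>). They imply that \<open>\<pi>\<close> is multiplicative
(\<open>composition\<close>). Hence \<open>v = (u \<circ> u)/\<pi>(u)\<close> has \<open>\<pi>(v) = \<pi>(u)\<^sup>2/\<pi>(u)\<^sup>2 = 1\<close>, and the two identities at \<open>v\<close>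
say that left and right multiplication by \<open>v\<close> are inverse to each other. Thus the product of the
theorem is \<open>(v \<circ> z) \<circ> (w \<circ> v)\<close>, which has the unit \<open>v \<circ> v\<close> and for which \<open>\<pi>\<close> is again
multiplicative (\<open>hurwitz_kaplansky\<close>). The dimension is \<open>9 - 1 = 8\<close>, and \<open>\<pi>(x) = 0\<close> for the generator
\<open>x\<close>, whose characteristic polynomial is \<open>X\<^sup>3 - a\<close>; so the octonion algebra is not a division algebra.

What has to be supplied is the structure of the symbol algebra, which is given by generators and
relations, and its reduced characteristic polynomial, which is defined through all splittings. The
universal property of the presentation (\<open>symbol_algebra_hom\<close>) yields one splitting by matrices over
the algebraic closure. Under any splitting, every monomial \<open>x\<^sup>iy\<^sup>j\<close> with \<open>0 \<le> i, j < 3\<close> other than the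
unit is multiplied by a primitive cube root of unity when it is conjugated by \<open>x\<close> or by \<open>y\<close>, so its
trace and its second coefficient vanish. As the monomials span, the coefficients of the
characteristic polynomial of an image lie in the base field and are the same for all splittings
(\<open>reduced_char_poly_splitting\<close>). The same values show that the trace form is nondegenerate; hence the
monomials form a basis, splittings are injective, and matrix identities such as Cayley-Hamilton
descend to the symbol algebra. All identities are obtained without dividing by 2, so that
characteristic 2 needs no separate treatment.
\<close>

section \<open>Coefficients of the characteristic polynomial of a three by three matrix\<close>

lemma less_3_cases: "(i::nat) < 3 \<longleftrightarrow> i = 0 \<or> i = 1 \<or> i = 2"
  by auto

lemma eq_mat3_iff:
  assumes "A \<in> carrier_mat 3 3" "B \<in> carrier_mat 3 3"
  shows "A = B \<longleftrightarrow> (\<forall>i\<in>{0,1,2}. \<forall>j\<in>{0,1,2}. A $$ (i, j) = B $$ (i, j))"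
  using assms by (auto intro!: eq_matI simp: less_3_cases)

lemma index_mult_mat3:
  fixes A B :: "'a::comm_ring_1 mat"
  assumes "A \<in> carrier_mat 3 3" "B \<in> carrier_mat 3 3" "i < 3" "j < 3"
  shows "(A * B) $$ (i, j) = A $$ (i, 0) * B $$ (0, j) + A $$ (i, 1) * B $$ (1, j) + A $$ (i, 2) * B $$ (2, j)"
  using assms by (simp add: scalar_prod_def numeral_3_eq_3 numeral_2_eq_2)

lemmas mat3_simps = index_mult_mat3 mult_carrier_mat[of _ 3 3 _ 3] less_3_cases

definition mat3_trace :: "'a::comm_ring_1 mat \<Rightarrow> 'a" where
  "mat3_trace A = A $$ (0,0) + A $$ (1,1) + A $$ (2,2)"

text \<open>The sum of the principal two by two minors.\<close>
definition mat3_minors :: "'a::comm_ring_1 mat \<Rightarrow> 'a" where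
  "mat3_minors A = A $$ (0,0) * A $$ (1,1) - A $$ (0,1) * A $$ (1,0)
     + A $$ (0,0) * A $$ (2,2) - A $$ (0,2) * A $$ (2,0)
     + A $$ (1,1) * A $$ (2,2) - A $$ (1,2) * A $$ (2,1)"

lemma det_mat2:
  assumes "A \<in> carrier_mat 2 2"
  shows "det A = A $$ (0,0) * A $$ (1,1) - A $$ (0,1) * A $$ (1,0)"
proof -
  have "det A = (\<Sum>i<2. A $$ (i,0) * cofactor A i 0)"
    using assms by (intro laplace_expansion_column) auto
  then show ?thesis using assms
    by (simp add: cofactor_def mat_delete_def numeral_2_eq_2 det_single algebra_simps)
qed

lemma det_mat3:
  assumes "A \<in> carrier_mat 3 3"
  shows "det A = A $$ (0,0) * A $$ (1,1) * A $$ (2,2) + A $$ (0,1) * A $$ (1,2) * A $$ (2,0)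
    + A $$ (0,2) * A $$ (1,0) * A $$ (2,1) - A $$ (0,2) * A $$ (1,1) * A $$ (2,0)
    - A $$ (0,1) * A $$ (1,0) * A $$ (2,2) - A $$ (0,0) * A $$ (1,2) * A $$ (2,1)"
proof -
  have "det A = (\<Sum>i<3. A $$ (i,0) * cofactor A i 0)"
    using assms by (intro laplace_expansion_column) auto
  moreover have "mat_delete A i 0 \<in> carrier_mat 2 2" for i
    using assms mat_delete_carrier[of A 3 3 i 0] by simp
  ultimately show ?thesis using assms
    by (simp add: cofactor_def det_mat2 numeral_3_eq_3)
      (simp add: mat_delete_def algebra_simps numeral_2_eq_2)
qed

lemma char_poly_mat3:
  fixes A :: "'a::comm_ring_1 mat"
  assumes A: "A \<in> carrier_mat 3 3"
  shows "char_poly A = [: - det A, mat3_minors A, - mat3_trace A, 1 :]"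
proof -
  have "char_poly A = det (char_poly_matrix A)" by (simp add: char_poly_def)
  also have "\<dots> = [: - det A, mat3_minors A, - mat3_trace A, 1 :]"
    using A by (simp add: det_mat3[OF char_poly_matrix_closed[OF A]] det_mat3[OF A])
      (simp add: char_poly_matrix_def mat3_minors_def mat3_trace_def algebra_simps)
  finally show ?thesis .
qed

text \<open>The polar form of the second coefficient is expressed by traces. Over a field of characteristic 2
the second coefficient itself is not, so it has to be carried along next to the trace.\<close>
lemma
  fixes A B :: "'a::comm_ring_1 mat"
  assumes "A \<in> carrier_mat 3 3" "B \<in> carrier_mat 3 3"
  shows mat3_trace_add: "mat3_trace (A + B) = mat3_trace A + mat3_trace B"
    and mat3_trace_commute: "mat3_trace (A * B) = mat3_trace (B * A)"
    and mat3_minors_add: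
      "mat3_minors (A + B) = mat3_minors A + mat3_minors B + mat3_trace A * mat3_trace B - mat3_trace (A * B)"
    and mat3_minors_commute: "mat3_minors (A * B) = mat3_minors (B * A)"
  using assms
  by (simp_all add: mat3_trace_def mat3_minors_def mat3_simps algebra_simps del: index_mult_mat(1))

lemma
  fixes A :: "'a::comm_ring_1 mat"
  assumes "A \<in> carrier_mat 3 3"
  shows mat3_trace_smult: "mat3_trace (c \<cdot>\<^sub>m A) = c * mat3_trace A"
    and mat3_minors_smult: "mat3_minors (c \<cdot>\<^sub>m A) = c\<^sup>2 * mat3_minors A"
  using assms by (simp_all add: mat3_trace_def mat3_minors_def power2_eq_square algebra_simps)

lemma mat3_trace_one: "mat3_trace (1\<^sub>m 3 :: 'a::comm_ring_1 mat) = 3"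
  and mat3_minors_one: "mat3_minors (1\<^sub>m 3 :: 'a::comm_ring_1 mat) = 3"
  by (simp_all add: mat3_trace_def mat3_minors_def)

text \<open>One of Newton's identities. Because 3 is invertible in the application, it shows that the
determinant lies in a subfield that contains the traces of the powers and the second coefficient.\<close>
lemma three_det_mat3:
  assumes "A \<in> carrier_mat 3 3"
  shows "3 * det A = mat3_trace (A * (A * A)) - mat3_trace A * mat3_trace (A * A) + mat3_minors A * mat3_trace A"
  using assms
  by (simp add: det_mat3 mat3_minors_def mat3_trace_def mat3_simps algebra_simps del: index_mult_mat(1))

text \<open>The part of the Cayley-Hamilton identity for \<open>A + B\<close> that is quadratic in \<open>A\<close> and linear in
\<open>B\<close>. Checking it entrywise gives it over every commutative ring, whereas extracting it from the
identity itself would require enough scalars.\<close>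
lemma cayley_hamilton_mat3_polarized:
  assumes A: "A \<in> carrier_mat 3 3" and B: "B \<in> carrier_mat 3 3"
    and tA: "mat3_trace A = 0" and tB: "mat3_trace B = 0"
  shows "A * (A * B) + A * (B * A) + B * (A * A) + mat3_minors A \<cdot>\<^sub>m B =
    mat3_trace (A * B) \<cdot>\<^sub>m A + mat3_trace (A * (A * B)) \<cdot>\<^sub>m 1\<^sub>m 3"
proof -
  have 1: "A $$ (2,2) = - A $$ (0,0) - A $$ (1,1)" and 2: "B $$ (2,2) = - B $$ (0,0) - B $$ (1,1)"
    using tA tB by (simp_all add: mat3_trace_def eq_neg_iff_add_eq_0 algebra_simps)
  show ?thesis
    by (subst eq_mat3_iff)
      (use A B in \<open>simp_all add: 1 2 mat3_minors_def mat3_trace_def mat3_simps algebra_simps del: index_mult_mat(1)\<close>)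
qed

lemma smult_smult_mat: "c \<cdot>\<^sub>m (d \<cdot>\<^sub>m A) = (c * d :: 'a::comm_ring_1) \<cdot>\<^sub>m A"
  by (rule eq_matI) (simp_all add: mult.assoc)

lemma one_smult_mat: "(1 :: 'a::comm_ring_1) \<cdot>\<^sub>m A = A"
  by (rule eq_matI) simp_all

text \<open>Conjugation by \<open>G\<close> multiplies \<open>A\<close> by \<open>\<zeta>\<close> and preserves the characteristic polynomial, so a
coefficient that is homogeneous of degree \<open>d\<close> in \<open>A\<close> can be nonzero only if \<open>\<zeta>\<^sup>d = 1\<close>.\<close>
lemma twisted_commuting_mat3:
  fixes A G :: "'a::field mat"
  assumes A: "A \<in> carrier_mat 3 3" and G: "G \<in> carrier_mat 3 3"
    and cube: "G * (G * G) = g \<cdot>\<^sub>m 1\<^sub>m 3" and "g \<noteq> 0"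
    and twist: "G * A = \<zeta> \<cdot>\<^sub>m (A * G)"
  shows "\<zeta> \<noteq> 1 \<Longrightarrow> mat3_trace A = 0" and "\<zeta>\<^sup>2 \<noteq> 1 \<Longrightarrow> mat3_minors A = 0"
proof -
  have conj: "(G * A) * (G * G) = (\<zeta> * g) \<cdot>\<^sub>m A"
    by (simp add: twist mult_carrier_mat[of _ 3 3 _ 3] mult_smult_assoc_mat[of _ 3 3 _ 3] assoc_mult_mat[of _ 3 3 _ 3 _ 3] A G
        cube mult_smult_distrib[of _ 3 3 _ 3] smult_smult_mat right_mult_one_mat[of _ 3 3])
  have conj': "(G * G) * (G * A) = g \<cdot>\<^sub>m A"
  proof -
    have "(G * G) * (G * A) = (G * (G * G)) * A"
      by (simp add: assoc_mult_mat[of _ 3 3 _ 3 _ 3] mult_carrier_mat[of _ 3 3 _ 3] A G)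
    then show ?thesis
      by (simp add: cube mult_smult_assoc_mat[of _ 3 3 _ 3] left_mult_one_mat[of _ 3 3] A)
  qed
  have "\<zeta> * (g * mat3_trace A) = g * mat3_trace A"
    using mat3_trace_commute[of "G * A" "G * G"] A G by (auto simp: conj conj' mat3_trace_smult)
  then show "mat3_trace A = 0" if "\<zeta> \<noteq> 1" using that \<open>g \<noteq> 0\<close> by auto
  have "\<zeta>\<^sup>2 * (g\<^sup>2 * mat3_minors A) = g\<^sup>2 * mat3_minors A"
    using mat3_minors_commute[of "G * A" "G * G"] A G
    by (auto simp: conj conj' mat3_minors_smult power_mult_distrib)
  then show "mat3_minors A = 0" if "\<zeta>\<^sup>2 \<noteq> 1" using that \<open>g \<noteq> 0\<close> by auto
qed

section \<open>Evaluation of noncommutative polynomials in a unital algebra\<close>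

lemma ring_of_type_algebra_ring: "ring (ring_of_type_algebra :: 'r::ring_1 ring)"
proof -
  have "\<exists>y. x + y = 0" for x :: 'r
    using add.right_inverse by blast
  then show ?thesis
    unfolding ring_of_type_algebra_def using add.right_inverse
    by unfold_locales (auto simp: algebra_simps Units_def)
qed

locale unital_algebra =
  fixes scale :: "'k::field \<Rightarrow> 's::ab_group_add \<Rightarrow> 's"
    and mul :: "'s \<Rightarrow> 's \<Rightarrow> 's" and e :: 's
  assumes assoc_algebra: "assoc_algebra scale mul e"
begin

sublocale vector_space scale
  using assoc_algebra by (simp add: assoc_algebra_def)

lemma mul_linear_right: "Vector_Spaces.linear scale scale (\<lambda>w. mul z w)"
  and mul_linear_left: "Vector_Spaces.linear scale scale (\<lambda>z. mul z w)"
  and mul_assoc: "mul (mul z w) t = mul z (mul w t)"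
  and mul_e_left [simp]: "mul e z = z"
  and mul_e_right [simp]: "mul z e = z"
  using assoc_algebra by (simp_all add: assoc_algebra_def)

lemma mul_add_right: "mul z (w + t) = mul z w + mul z t"
  and mul_add_left: "mul (w + t) z = mul w z + mul t z"
  and mul_scale_right: "mul z (scale c w) = scale c (mul z w)"
  and mul_scale_left: "mul (scale c w) z = scale c (mul w z)"
  and mul_diff_right: "mul z (w - t) = mul z w - mul z t"
  and mul_diff_left: "mul (w - t) z = mul w z - mul t z"
  and mul_minus_right: "mul z (- w) = - mul z w"
  and mul_minus_left: "mul (- w) z = - mul w z"
  and mul_zero_right [simp]: "mul z 0 = 0"
  and mul_zero_left [simp]: "mul 0 z = 0"
  and mul_sum_right: "mul z (\<Sum>i\<in>I. f i) = (\<Sum>i\<in>I. mul z (f i))"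
  and mul_sum_left: "mul (\<Sum>i\<in>I. f i) z = (\<Sum>i\<in>I. mul (f i) z)"
proof -
  interpret r: Vector_Spaces.linear scale scale "\<lambda>w. mul z w" by (rule mul_linear_right)
  interpret l: Vector_Spaces.linear scale scale "\<lambda>w. mul w z" by (rule mul_linear_left)
  show "mul z (w + t) = mul z w + mul z t" "mul z (scale c w) = scale c (mul z w)"
    "mul z (w - t) = mul z w - mul z t" "mul z (- w) = - mul z w" "mul z 0 = 0"
    "mul z (\<Sum>i\<in>I. f i) = (\<Sum>i\<in>I. mul z (f i))"
    by (simp_all add: r.add r.scale r.diff r.neg r.zero r.sum)
  show "mul (w + t) z = mul w z + mul t z" "mul (scale c w) z = scale c (mul w z)"
    "mul (w - t) z = mul w z - mul t z" "mul (- w) z = - mul w z" "mul 0 z = 0"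
    "mul (\<Sum>i\<in>I. f i) z = (\<Sum>i\<in>I. mul (f i) z)"
    by (simp_all add: l.add l.scale l.diff l.neg l.zero l.sum)
qed

lemmas mul_bilinear = mul_add_right mul_add_left mul_scale_right mul_scale_left
  mul_diff_right mul_diff_left mul_minus_right mul_minus_left

lemma eval_word_add: "eval_word mul e x y (u + w) = mul (eval_word mul e x y u) (eval_word mul e x y w)"
proof -
  have "mul (foldr (\<lambda>l r. mul (case l of Letter_x \<Rightarrow> x | Letter_y \<Rightarrow> y) r) ls e) t =
      foldr (\<lambda>l r. mul (case l of Letter_x \<Rightarrow> x | Letter_y \<Rightarrow> y) r) ls t" for ls t
    by (induction ls) (simp_all add: mul_assoc)
  then show ?thesis
    by (simp add: eval_word_def plus_word_def)
qed

lemma eval_free_superset: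
  assumes "finite A" "Poly_Mapping.keys p \<subseteq> A"
  shows "eval_free scale mul e x y p = (\<Sum>w\<in>A. scale (Poly_Mapping.lookup p w) (eval_word mul e x y w))"
  unfolding eval_free_def using assms
  by (intro sum.mono_neutral_left) (auto simp: in_keys_iff)

lemma eval_free_add:
  "eval_free scale mul e x y (p + q) = eval_free scale mul e x y p + eval_free scale mul e x y q"
proof -
  let ?A = "Poly_Mapping.keys p \<union> Poly_Mapping.keys q"
  have "finite ?A" by simp
  then show ?thesis
    using keys_add[of p q]
    by (simp add: eval_free_superset[of ?A] lookup_add scale_left_distrib sum.distrib)
qed

lemma eval_free_single:
  "eval_free scale mul e x y (Poly_Mapping.single w c) = scale c (eval_word mul e x y w)"
  by (simp add: eval_free_def lookup_single when_def)

lemma eval_free_zero [simp]: "eval_free scale mul e x y 0 = 0"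
  by (simp add: eval_free_def)

lemma eval_free_uminus: "eval_free scale mul e x y (- p) = - eval_free scale mul e x y p"
  using eval_free_add[of x y p "- p"] by (simp add: eq_neg_iff_add_eq_0 add.commute)

lemma eval_free_diff:
  "eval_free scale mul e x y (p - q) = eval_free scale mul e x y p - eval_free scale mul e x y q"
  using eval_free_add[of x y p "- q"] by (simp add: eval_free_uminus)

lemma eval_free_sum:
  "eval_free scale mul e x y (\<Sum>i\<in>I. p i) = (\<Sum>i\<in>I. eval_free scale mul e x y (p i))"
  by (induction I rule: infinite_finite_induct) (simp_all add: eval_free_add)

lemma sum_single_lookup: "(\<Sum>w\<in>Poly_Mapping.keys p. Poly_Mapping.single w (Poly_Mapping.lookup p w)) = p"
  by (rule poly_mapping_eqI)
    (auto simp: Poly_Mapping.lookup_sum lookup_single when_def in_keys_iff)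

lemma eval_free_mult:
  "eval_free scale mul e x y (p * q) = mul (eval_free scale mul e x y p) (eval_free scale mul e x y q)"
proof -
  let ?ev = "eval_free scale mul e x y"
  have single: "?ev (Poly_Mapping.single v c * Poly_Mapping.single w d) =
      mul (?ev (Poly_Mapping.single v c)) (?ev (Poly_Mapping.single w d))" for v w c d
    by (simp add: mult_single eval_free_single eval_word_add mul_bilinear)
  have "?ev (p * q) = ?ev ((\<Sum>v\<in>Poly_Mapping.keys p. Poly_Mapping.single v (Poly_Mapping.lookup p v)) *
      (\<Sum>w\<in>Poly_Mapping.keys q. Poly_Mapping.single w (Poly_Mapping.lookup q w)))"
    by (simp only: sum_single_lookup)
  also have "\<dots> = mul (?ev (\<Sum>v\<in>Poly_Mapping.keys p. Poly_Mapping.single v (Poly_Mapping.lookup p v)))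
      (?ev (\<Sum>w\<in>Poly_Mapping.keys q. Poly_Mapping.single w (Poly_Mapping.lookup q w)))"
    by (simp only: sum_product eval_free_sum single mul_sum_left mul_sum_right
        sum.swap[of _ "Poly_Mapping.keys p"])
  finally show ?thesis
    by (simp only: sum_single_lookup)
qed

lemma eval_free_const: "eval_free scale mul e x y (free_const c) = scale c e"
  by (simp add: free_const_def eval_free_single eval_word_def zero_word_def)

lemma eval_free_one: "eval_free scale mul e x y 1 = e"
  using eval_free_const[of x y 1] by (simp add: free_const_def)

lemma eval_free_x: "eval_free scale mul e x y free_x = x"
  and eval_free_y: "eval_free scale mul e x y free_y = y"
  by (simp_all add: free_x_def free_y_def eval_free_single eval_word_def)

lemma eval_free_power: "eval_free scale mul e x y (p ^ n) = ((mul (eval_free scale mul e x y p)) ^^ n) e"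
  by (induction n) (simp_all add: eval_free_mult eval_free_one)

lemmas eval_free_simps = eval_free_add eval_free_diff eval_free_mult eval_free_const
  eval_free_x eval_free_y eval_free_power

text \<open>This turns statements about the generated ideal of relators into statements about evaluations:
an ideal generated inside a kernel stays inside it.\<close>
lemma ideal_eval_free_kernel: "ideal {p. eval_free scale mul e x y p = 0} ring_of_type_algebra"
proof (rule idealI[OF ring_of_type_algebra_ring])
  let ?F = "ring_of_type_algebra :: (word \<Rightarrow>\<^sub>0 'k) ring"
  let ?I = "{p. eval_free scale mul e x y p = 0}"
  interpret F: ring ?F by (rule ring_of_type_algebra_ring)
  have uminus: "inv\<^bsub>add_monoid ?F\<^esub> p = - p" for p
    by (rule F.minus_equality[of "- p" p, unfolded a_inv_def]) (simp_all add: ring_of_type_algebra_def)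
  show "subgroup ?I (add_monoid ?F)"
  proof (rule F.add.subgroupI)
    fix p assume "p \<in> ?I"
    then show "\<ominus>\<^bsub>?F\<^esub> p \<in> ?I"
      using uminus[of p] by (simp add: a_inv_def eval_free_uminus)
  next
    show "?I \<noteq> {}" using eval_free_zero[of x y] by blast
  qed (auto simp: ring_of_type_algebra_def eval_free_add)
qed (simp_all add: ring_of_type_algebra_def eval_free_mult)

end

section \<open>The universal property and the existence of a splitting\<close>

text \<open>The relations inside an algebra whose product is a term; the \<open>n\<close>-th power of \<open>x\<close> is \<open>n\<close>-fold
left multiplication by \<open>x\<close> applied to the unit.\<close>
definition symbol_relations ::
    "('k::field \<Rightarrow> 's::ab_group_add \<Rightarrow> 's) \<Rightarrow> ('s \<Rightarrow> 's \<Rightarrow> 's) \<Rightarrow> 's \<Rightarrow> nat \<Rightarrow> 'k \<Rightarrow> 'k \<Rightarrow> 'k \<Rightarrow> 's \<Rightarrow> 's \<Rightarrow> bool" where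
  "symbol_relations scale mul e n \<xi> a b x y \<longleftrightarrow>
     (mul x ^^ n) e = scale a e \<and> (mul y ^^ n) e = scale b e \<and> mul y x = scale \<xi> (mul x y)"

lemma symbol_relators_subset_kernel:
  assumes "assoc_algebra scale mul e"
  shows "{free_x ^ n - free_const a, free_y ^ n - free_const b,
      free_y * free_x - free_const \<xi> * free_x * free_y} \<subseteq> {p. eval_free scale mul e x y p = 0}
    \<longleftrightarrow> symbol_relations scale mul e n \<xi> a b x y"
proof -
  interpret unital_algebra scale mul e by unfold_locales (rule assms)
  show ?thesis
    by (simp add: symbol_relations_def eval_free_simps mul_bilinear)
qed

text \<open>A symbol algebra is free on its relations. The homomorphism sends \<open>z\<close> to the value, at the new
generators, of any polynomial that evaluates to \<open>z\<close> at the old ones; two such polynomials differ by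
an element of the ideal of relators, on which the new evaluation vanishes.\<close>
lemma symbol_algebra_hom:
  assumes S: "symbol_algebra scale mul e n \<xi> a b"
    and A: "assoc_algebra scale' mul' e'"
    and rel: "symbol_relations scale' mul' e' n \<xi> a b x' y'"
  obtains \<phi> where "\<And>z w. \<phi> (z + w) = \<phi> z + \<phi> w" "\<And>c z. \<phi> (scale c z) = scale' c (\<phi> z)"
    "\<And>z w. \<phi> (mul z w) = mul' (\<phi> z) (\<phi> w)" "\<phi> e = e'"
proof -
  interpret S: unital_algebra scale mul e
    using S by unfold_locales (simp add: symbol_algebra_def)
  interpret A: unital_algebra scale' mul' e'
    by unfold_locales (rule A)
  obtain x y where surj: "surj (eval_free scale mul e x y)"
    and ker: "{p. eval_free scale mul e x y p = 0} = genideal ring_of_type_algebra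
        {free_x ^ n - free_const a, free_y ^ n - free_const b,
          free_y * free_x - free_const \<xi> * free_x * free_y}"
    using S by (auto simp: symbol_algebra_def)
  define ev where "ev = eval_free scale mul e x y"
  define ev' where "ev' = eval_free scale' mul' e' x' y'"
  have "{p. ev p = 0} \<subseteq> {p. ev' p = 0}"
    unfolding ev_def ev'_def ker
    using symbol_relators_subset_kernel[OF A] rel
    by (intro ring.genideal_minimal ring_of_type_algebra_ring A.ideal_eval_free_kernel) blast
  then have kernel: "ev' p = ev' q" if "ev p = ev q" for p q
    using that by (auto simp: ev_def ev'_def S.eval_free_diff A.eval_free_diff
        dest!: subsetD[of _ _ "p - q"])
  define \<phi> where "\<phi> z = ev' (inv_into UNIV ev z)" for z
  have ev_inv: "ev (inv_into UNIV ev z) = z" for z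
    using surj by (simp add: ev_def surj_f_inv_f)
  have \<phi>: "\<phi> (ev p) = ev' p" for p
    unfolding \<phi>_def by (rule kernel) (rule ev_inv)
  show thesis
  proof (rule that[of \<phi>])
    show "\<phi> (z + w) = \<phi> z + \<phi> w" for z w
      using \<phi>[of "inv_into UNIV ev z + inv_into UNIV ev w"]
      by (simp add: ev_def ev'_def S.eval_free_add A.eval_free_add)
        (simp add: \<phi>_def flip: ev_def ev'_def, simp add: ev_inv)
    show "\<phi> (mul z w) = mul' (\<phi> z) (\<phi> w)" for z w
      using \<phi>[of "inv_into UNIV ev z * inv_into UNIV ev w"]
      by (simp add: ev_def ev'_def S.eval_free_mult A.eval_free_mult)
        (simp add: \<phi>_def flip: ev_def ev'_def, simp add: ev_inv)
    show "\<phi> (scale c z) = scale' c (\<phi> z)" for c z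
      using \<phi>[of "free_const c * inv_into UNIV ev z"]
      by (simp add: ev_def ev'_def S.eval_free_mult A.eval_free_mult S.eval_free_const
          A.eval_free_const S.mul_bilinear A.mul_bilinear)
        (simp add: \<phi>_def flip: ev_def ev'_def, simp add: ev_inv)
    show "\<phi> e = e'"
      using \<phi>[of 1] by (simp add: ev_def ev'_def S.eval_free_one A.eval_free_one)
  qed
qed

lemma symbol_algebra_generators:
  assumes S: "symbol_algebra scale mul e n \<xi> a b"
  obtains x y where "surj (eval_free scale mul e x y)" "symbol_relations scale mul e n \<xi> a b x y"
proof -
  from S obtain x y where surj: "surj (eval_free scale mul e x y)"
    and ker: "{p. eval_free scale mul e x y p = 0} = genideal ring_of_type_algebra
        {free_x ^ n - free_const a, free_y ^ n - free_const b,
          free_y * free_x - free_const \<xi> * free_x * free_y}"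
    and A: "assoc_algebra scale mul e"
    by (auto simp: symbol_algebra_def)
  from ring.genideal_self[OF ring_of_type_algebra_ring]
  have "symbol_relations scale mul e n \<xi> a b x y"
    unfolding symbol_relators_subset_kernel[OF A, symmetric] ker
    by (metis (full_types) UNIV_I partial_object.select_convs(1) ring_of_type_algebra_def subsetI)
  with surj show thesis by (rule that)
qed

text \<open>The three by three matrices as a type of their own, so that they form an algebra on a whole type and
the universal property applies to them.\<close>
typedef (overloaded) 'a mat3 = "carrier_mat 3 3 :: 'a mat set"
  by (auto intro: mat_carrier)

setup_lifting type_definition_mat3

instantiation mat3 :: (field) ab_group_add
begin

lift_definition zero_mat3 :: "'a mat3" is "0\<^sub>m 3 3" by simp
lift_definition plus_mat3 :: "'a mat3 \<Rightarrow> 'a mat3 \<Rightarrow> 'a mat3" is "(+)" by simp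
lift_definition minus_mat3 :: "'a mat3 \<Rightarrow> 'a mat3 \<Rightarrow> 'a mat3" is "\<lambda>A B. A + - B" by simp
lift_definition uminus_mat3 :: "'a mat3 \<Rightarrow> 'a mat3" is "uminus" by simp

instance
  by intro_classes (transfer; auto simp: add.commute)+

end

lift_definition one_mat3 :: "'a::field mat3" is "1\<^sub>m 3" by simp
lift_definition mult_mat3 :: "'a::field mat3 \<Rightarrow> 'a mat3 \<Rightarrow> 'a mat3" is "(*)" by (rule mult_carrier_mat)
lift_definition smult_mat3 :: "'a::field \<Rightarrow> 'a mat3 \<Rightarrow> 'a mat3" is "(\<cdot>\<^sub>m)" by simp

lemma assoc_algebra_mat3: "assoc_algebra (\<lambda>c. smult_mat3 (to_ac c)) mult_mat3 one_mat3"
proof -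
  have vs: "vector_space (\<lambda>c. smult_mat3 (to_ac c))"
    by unfold_locales
      (transfer; auto simp: algebra_simps add_smult_distrib_left_mat add_smult_distrib_right_mat)+
  show ?thesis
    unfolding assoc_algebra_def
  proof (intro conjI allI vs)
    fix z w t :: "'a alg_closure mat3"
    show "Vector_Spaces.linear (\<lambda>c. smult_mat3 (to_ac c)) (\<lambda>c. smult_mat3 (to_ac c)) (mult_mat3 z)"
      unfolding Vector_Spaces.linear_iff
      by (intro conjI allI vs; transfer; simp add: mult_add_distrib_mat[of _ 3 3] mult_smult_distrib[of _ 3 3])
    show "Vector_Spaces.linear (\<lambda>c. smult_mat3 (to_ac c)) (\<lambda>c. smult_mat3 (to_ac c)) (\<lambda>z. mult_mat3 z w)"
      unfolding Vector_Spaces.linear_iff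
      by (intro conjI allI vs; transfer; simp add: add_mult_distrib_mat[of _ 3 3] mult_smult_assoc_mat[of _ 3 3])
  qed (transfer; simp add: assoc_mult_mat)+
qed

text \<open>With \<open>\<alpha>\<^sup>3 = a\<close>, the diagonal matrix \<open>diag(\<alpha>, \<xi>\<^sup>2\<alpha>, \<xi>\<alpha>)\<close> and the cyclic shift whose corner entry
is \<open>b\<close> satisfy the relations of \<open>x\<close> and \<open>y\<close>. Without this representation the condition that
defines the reduced characteristic polynomial would be vacuous, and \<open>\<tau>\<close> and \<open>\<pi>\<close> would be arbitrary.\<close>
lemma splitting_rep_exists:
  fixes scale :: "'k::field \<Rightarrow> 's::ab_group_add \<Rightarrow> 's"
  assumes S: "symbol_algebra scale mul e 3 \<xi> a b"
  shows "\<exists>\<phi>. splitting_rep 3 scale mul e \<phi>"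
proof -
  obtain \<alpha> where \<alpha>: "\<alpha> ^ 3 = to_ac a"
    using nth_root_exists[of 3 "to_ac a"] by auto
  define r where "r = to_ac \<xi>"
  have "r ^ 3 = 1"
    using S by (simp add: r_def symbol_algebra_def primitive_root_of_unity_def flip: to_ac_power)
  then have r: "r * (r * r) = 1" "r * (r * (r * t)) = t" for t
    by (simp_all add: power3_eq_cube mult.assoc[symmetric])
  have \<alpha>': "\<alpha> * (\<alpha> * \<alpha>) = to_ac a" "\<alpha> * (\<alpha> * (\<alpha> * t)) = to_ac a * t" for t
    using \<alpha> by (simp_all add: power3_eq_cube mult.assoc[symmetric])
  have funpow_3: "(f ^^ 3) t = f (f (f t))" for f :: "'k alg_closure mat3 \<Rightarrow> _" and t
    by (simp add: numeral_3_eq_3)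
  define x' where "x' = Abs_mat3 (mat 3 3 (\<lambda>(i, j). if i = j then [\<alpha>, \<alpha> * (r * r), \<alpha> * r] ! i else 0))"
  define y' where "y' = Abs_mat3 (mat 3 3 (\<lambda>(i, j). if i = j + 1 then 1 else if i = 0 \<and> j = 2 then to_ac b else 0))"
  have [simp]: "Rep_mat3 x' = mat 3 3 (\<lambda>(i, j). if i = j then [\<alpha>, \<alpha> * (r * r), \<alpha> * r] ! i else 0)"
    "Rep_mat3 y' = mat 3 3 (\<lambda>(i, j). if i = j + 1 then 1 else if i = 0 \<and> j = 2 then to_ac b else 0)"
    unfolding x'_def y'_def by (subst Abs_mat3_inverse; simp)+
  have rel: "symbol_relations (\<lambda>c. smult_mat3 (to_ac c)) mult_mat3 one_mat3 3 \<xi> a b x' y'"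
    by (simp add: symbol_relations_def Rep_mat3_inject[symmetric] mult_mat3.rep_eq smult_mat3.rep_eq
        one_mat3.rep_eq funpow_3)
      (simp add: eq_mat3_iff mat3_simps mult_ac r \<alpha>' flip: r_def
        del: index_mult_mat(1))
  from symbol_algebra_hom[OF S assoc_algebra_mat3 rel]
  obtain \<phi> where \<phi>: "\<And>z w. \<phi> (z + w) = \<phi> z + \<phi> w"
    "\<And>c z. \<phi> (scale c z) = smult_mat3 (to_ac c) (\<phi> z)"
    "\<And>z w. \<phi> (mul z w) = mult_mat3 (\<phi> z) (\<phi> w)" "\<phi> e = one_mat3"
    by blast
  have "splitting_rep 3 scale mul e (\<lambda>z. Rep_mat3 (\<phi> z))"
    by (simp add: Rep_mat3 splitting_rep_def \<phi> plus_mat3.rep_eq smult_mat3.rep_eq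
        mult_mat3.rep_eq one_mat3.rep_eq)
  then show ?thesis by blast
qed

section \<open>Trace and second coefficient on a cubic symbol algebra\<close>

text \<open>A cubic symbol algebra with a choice of generators. The last three assumptions are the consequences
of the presentation on which the rest of the argument relies.\<close>
locale cubic_symbol_algebra = unital_algebra scale mul e
  for scale :: "'k::field \<Rightarrow> 's::ab_group_add \<Rightarrow> 's" and mul :: "'s \<Rightarrow> 's \<Rightarrow> 's" and e :: 's +
  fixes \<xi> a b :: 'k and x y :: 's
  assumes primitive: "primitive_root_of_unity 3 \<xi>" and char_not_3: "\<not> CHAR('k) dvd 3"
    and nonzero: "a \<noteq> 0" "b \<noteq> 0"
    and surj_eval: "surj (eval_free scale mul e x y)"
    and relations: "symbol_relations scale mul e 3 \<xi> a b x y"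
    and splitting_exists: "\<exists>\<phi>. splitting_rep 3 scale mul e \<phi>"
begin

lemma three_nonzero: "(3::'k) \<noteq> 0"
  using char_not_3 of_nat_eq_0_iff_char_dvd[where 'a='k, of 3] by simp

lemma \<xi>_cube: "\<xi> ^ 3 = 1" and \<xi>_neq_1: "\<xi> \<noteq> 1" and \<xi>_square_neq_1: "\<xi>\<^sup>2 \<noteq> 1" and \<xi>_nonzero: "\<xi> \<noteq> 0"
  using primitive by (auto simp: primitive_root_of_unity_def)

lemma \<xi>_square: "\<xi>\<^sup>2 = - \<xi> - 1"
proof -
  have "(\<xi> - 1) * (\<xi>\<^sup>2 + \<xi> + 1) = \<xi> ^ 3 - 1"
    by (simp add: algebra_simps power2_eq_square power3_eq_cube)
  then have "\<xi>\<^sup>2 + \<xi> + 1 = 0" using \<xi>_cube \<xi>_neq_1 by simp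
  then show ?thesis by (simp add: eq_neg_iff_add_eq_0 algebra_simps)
qed

definition monomial :: "nat \<Rightarrow> nat \<Rightarrow> 's" where
  "monomial i j = (mul x ^^ i) ((mul y ^^ j) e)"

lemma monomial_0_0 [simp]: "monomial 0 0 = e"
  by (simp add: monomial_def)

lemma x_monomial: "mul x (monomial i j) = monomial (Suc i) j"
  by (simp add: monomial_def)

lemma yx: "mul y x = scale \<xi> (mul x y)"
  using relations by (simp add: symbol_relations_def)

lemma y_monomial: "mul y (monomial i j) = scale (\<xi> ^ i) (monomial i (Suc j))"
proof (induction i)
  case (Suc i)
  have "mul y (monomial (Suc i) j) = mul (mul y x) (monomial i j)"
    by (simp only: x_monomial[symmetric] mul_assoc)
  also have "\<dots> = scale \<xi> (mul x (mul y (monomial i j)))"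
    by (simp add: yx mul_bilinear mul_assoc)
  finally show ?case
    by (simp add: Suc mul_bilinear x_monomial)
qed (simp add: monomial_def)

lemma funpow_mul_left: "(mul z ^^ n) (mul w t) = mul ((mul z ^^ n) w) t"
  by (induction n) (simp_all add: mul_assoc)

lemma monomial_mult:
  "mul (monomial i j) (monomial k l) = scale (\<xi> ^ (j * k)) (monomial (i + k) (j + l))"
proof -
  have y: "(mul y ^^ j) (monomial k l) = scale (\<xi> ^ (j * k)) (monomial k (j + l))"
    by (induction j) (simp_all add: mul_bilinear y_monomial power_add mult.commute)
  have x: "(mul x ^^ i) (scale c z) = scale c ((mul x ^^ i) z)" for c z
    by (induction i) (simp_all add: mul_bilinear)
  have "mul (monomial i j) (monomial k l) = (mul x ^^ i) ((mul y ^^ j) (monomial k l))"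
    by (simp add: monomial_def flip: funpow_mul_left)
  also have "\<dots> = scale (\<xi> ^ (j * k)) (monomial (i + k) (j + l))"
    by (simp add: y x) (simp add: monomial_def funpow_add)
  finally show ?thesis .
qed

lemma monomial_cube: "monomial (i + 3) j = scale a (monomial i j)"
  "monomial i (j + 3) = scale b (monomial i j)"
proof -
  have "monomial 3 0 = scale a e" "monomial 0 3 = scale b e"
    using relations by (simp_all add: monomial_def symbol_relations_def)
  then show "monomial (i + 3) j = scale a (monomial i j)" "monomial i (j + 3) = scale b (monomial i j)"
    using monomial_mult[of 3 0 i j] monomial_mult[of i j 0 3] by (simp_all add: mul_bilinear add.commute)
qed

lemma monomial_mod:
  "monomial i j = scale (a ^ (i div 3) * b ^ (j div 3)) (monomial (i mod 3) (j mod 3))"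
proof -
  have 1: "monomial (k + 3 * n) l = scale (a ^ n) (monomial k l)" for k l n
    by (induction n) (simp_all add: monomial_cube(1)[of "k + 3 * _", simplified add.assoc] add.commute[of 3])
  have 2: "monomial k (l + 3 * n) = scale (b ^ n) (monomial k l)" for k l n
    by (induction n) (simp_all add: monomial_cube(2)[of _ "l + 3 * _", simplified add.assoc] add.commute[of 3])
  have "monomial i j = monomial (i mod 3 + 3 * (i div 3)) (j mod 3 + 3 * (j div 3))"
    by simp
  then show ?thesis by (simp only: 1 2 scale_scale mult.commute)
qed

definition monomials :: "'s set" where
  "monomials = (\<lambda>(i, j). monomial i j) ` ({..<3} \<times> {..<3})"

text \<open>The relations move every \<open>y\<close> to the right of every \<open>x\<close> and reduce exponents modulo 3, at the price of
scalars.\<close>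
lemma span_monomials: "span monomials = UNIV"
proof -
  have mono: "monomial i j \<in> span monomials" for i j
    by (subst monomial_mod, rule span_scale, rule span_base) (auto simp: monomials_def)
  have "\<exists>c i j. foldr (\<lambda>l. mul (case l of Letter_x \<Rightarrow> x | Letter_y \<Rightarrow> y)) ls e = scale c (monomial i j)" for ls
  proof (induction ls)
    case Nil
    show ?case by (intro exI[of _ 1] exI[of _ 0]) simp
  next
    case (Cons l ls)
    then obtain c i j
      where "foldr (\<lambda>l. mul (case l of Letter_x \<Rightarrow> x | Letter_y \<Rightarrow> y)) ls e = scale c (monomial i j)"
      by blast
    then show ?case
      by (cases l) (auto simp: mul_bilinear x_monomial y_monomial)
  qed
  then have word: "eval_word mul e x y w \<in> span monomials" for w
    using mono by (metis eval_word_def span_scale)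
  have "eval_free scale mul e x y p \<in> span monomials" for p
    unfolding eval_free_def by (intro span_sum span_scale word)
  then show ?thesis
    using surj_eval by (metis UNIV_eq_I surj_def)
qed

lemma monomial_induct [case_names zero add]:
  assumes "P 0" "\<And>c i j z. i < 3 \<Longrightarrow> j < 3 \<Longrightarrow> P z \<Longrightarrow> P (scale c (monomial i j) + z)"
  shows "P z"
proof -
  have "z \<in> span monomials" by (simp add: span_monomials)
  then show ?thesis
    by (induction rule: span_induct_alt) (use assms in \<open>auto simp: monomials_def\<close>)
qed

context
  fixes \<phi> assumes \<phi>: "splitting_rep 3 scale mul e \<phi>"
begin

lemma \<phi>_simps:
  "\<phi> z \<in> carrier_mat 3 3"
  "\<phi> (z + w) = \<phi> z + \<phi> w"
  "\<phi> (scale c z) = to_ac c \<cdot>\<^sub>m \<phi> z"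
  "\<phi> (mul z w) = \<phi> z * \<phi> w"
  "\<phi> e = 1\<^sub>m 3"
  using \<phi> by (simp_all add: splitting_rep_def)

lemma \<phi>_zero: "\<phi> 0 = 0\<^sub>m 3 3"
proof -
  have "\<phi> 0 = 0 \<cdot>\<^sub>m \<phi> 0" using \<phi>_simps(3)[of 0 0] by simp
  also have "\<dots> = 0\<^sub>m 3 3" using \<phi>_simps(1)[of 0] by (intro eq_matI) auto
  finally show ?thesis .
qed

text \<open>A monomial commutes with \<open>x\<close> up to \<open>\<xi>\<^sup>j\<close> and with \<open>y\<close> up to \<open>\<xi>\<^sup>i\<close>, and one of these scalars is a
primitive cube root of unity unless the monomial is the unit. So the values do not depend on the
splitting.\<close>
lemma forms_splitting_monomial:
  assumes "i < 3" "j < 3"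
  shows "mat3_trace (\<phi> (monomial i j)) = (if i = 0 \<and> j = 0 then 3 else 0)"
    and "mat3_minors (\<phi> (monomial i j)) = (if i = 0 \<and> j = 0 then 3 else 0)"
proof -
  let ?A = "\<phi> (monomial i j)"
  have x: "\<phi> x * (\<phi> x * \<phi> x) = to_ac a \<cdot>\<^sub>m 1\<^sub>m 3" and y: "\<phi> y * (\<phi> y * \<phi> y) = to_ac b \<cdot>\<^sub>m 1\<^sub>m 3"
  proof -
    have "mul x (mul x x) = scale a e" "mul y (mul y y) = scale b e"
      using relations by (simp_all add: symbol_relations_def numeral_3_eq_3)
    then show "\<phi> x * (\<phi> x * \<phi> x) = to_ac a \<cdot>\<^sub>m 1\<^sub>m 3" "\<phi> y * (\<phi> y * \<phi> y) = to_ac b \<cdot>\<^sub>m 1\<^sub>m 3"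
      by (simp_all flip: \<phi>_simps)
  qed
  have *: "mat3_trace ?A = 0 \<and> mat3_minors ?A = 0" if ij: "i \<noteq> 0 \<or> j \<noteq> 0"
  proof -
    have xi: "\<xi> ^ k \<noteq> 1 \<and> (\<xi> ^ k)\<^sup>2 \<noteq> 1" if "k < 3" "k \<noteq> 0" for k
    proof -
      have "k = 1 \<or> k = 2" using that by auto
      moreover have "(\<xi>\<^sup>2)\<^sup>2 = \<xi>" using \<xi>_cube by (simp add: power2_eq_square power3_eq_cube mult.assoc)
      ultimately show ?thesis using \<xi>_neq_1 \<xi>_square_neq_1 by auto
    qed
    have to_ac_power_neq: "to_ac c \<noteq> 1 \<and> (to_ac c)\<^sup>2 \<noteq> 1" if "c \<noteq> 1 \<and> c\<^sup>2 \<noteq> 1" for c :: 'k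
      using that by (metis to_ac_eq_1_iff to_ac_power)
    have mono: "monomial (Suc 0) 0 = x" "monomial 0 (Suc 0) = y"
      by (simp_all add: monomial_def)
    consider "i \<noteq> 0" | "j \<noteq> 0" using ij by blast
    then show ?thesis
    proof cases
      case 1
      have "mul y (monomial i j) = scale (\<xi> ^ i) (mul (monomial i j) y)"
        using monomial_mult[of i j 0 1] by (simp add: mono y_monomial)
      then have "\<phi> y * ?A = to_ac (\<xi> ^ i) \<cdot>\<^sub>m (?A * \<phi> y)"
        by (simp del: to_ac_power flip: \<phi>_simps)
      with y show ?thesis
        using twisted_commuting_mat3[of ?A "\<phi> y" "to_ac b" "to_ac (\<xi> ^ i)"]
          to_ac_power_neq[OF xi[OF \<open>i < 3\<close> 1]] nonzero by (simp add: \<phi>_simps(1) del: to_ac_power)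
    next
      case 2
      have "mul (monomial i j) x = scale (\<xi> ^ j) (mul x (monomial i j))"
        using monomial_mult[of i j 1 0] by (simp add: mono x_monomial)
      then have "?A * \<phi> x = to_ac (\<xi> ^ j) \<cdot>\<^sub>m (\<phi> x * ?A)"
        by (simp del: to_ac_power flip: \<phi>_simps)
      then have "to_ac (inverse (\<xi> ^ j)) \<cdot>\<^sub>m (?A * \<phi> x) = \<phi> x * ?A"
        using \<xi>_nonzero by (simp add: smult_smult_mat one_smult_mat)
      moreover have "inverse (\<xi> ^ j) \<noteq> 1 \<and> (inverse (\<xi> ^ j))\<^sup>2 \<noteq> 1"
        using xi[OF \<open>j < 3\<close> 2] by (simp add: power_inverse)
      ultimately show ?thesis
        using x twisted_commuting_mat3[of ?A "\<phi> x" "to_ac a" "to_ac (inverse (\<xi> ^ j))"]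
          to_ac_power_neq[of "inverse (\<xi> ^ j)"] nonzero 
        by (simp add: \<phi>_simps(1) del: to_ac_power to_ac_inverse)
    qed
  qed
  show "mat3_trace ?A = (if i = 0 \<and> j = 0 then 3 else 0)"
    "mat3_minors ?A = (if i = 0 \<and> j = 0 then 3 else 0)"
    using * by (auto simp: \<phi>_simps mat3_trace_one mat3_minors_one)
qed

end

text \<open>Trace and second coefficient of the image of an element lie in the base field and are the same for
all splittings: this holds on the monomials, and it passes to linear combinations. For the second
coefficient, whose polar form involves traces of products, the trace has to be treated first.\<close>
lemma trace_splitting_rational: "\<exists>t. \<forall>\<phi>. splitting_rep 3 scale mul e \<phi> \<longrightarrow> mat3_trace (\<phi> z) = to_ac t"
proof (induction z rule: monomial_induct)
  case zero
  show ?case by (intro exI[of _ 0]) (simp add: \<phi>_zero mat3_trace_def)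
next
  case (add c i j z)
  then obtain t where "\<forall>\<phi>. splitting_rep 3 scale mul e \<phi> \<longrightarrow> mat3_trace (\<phi> z) = to_ac t" by blast
  with add(1,2) show ?case
    by (intro exI[of _ "c * (if i = 0 \<and> j = 0 then 3 else 0) + t"])
      (simp add: \<phi>_simps mat3_trace_add mat3_trace_smult forms_splitting_monomial)
qed

lemma minors_splitting_rational: "\<exists>t. \<forall>\<phi>. splitting_rep 3 scale mul e \<phi> \<longrightarrow> mat3_minors (\<phi> z) = to_ac t"
proof (induction z rule: monomial_induct)
  case zero
  show ?case by (intro exI[of _ 0]) (simp add: \<phi>_zero mat3_minors_def)
next
  case (add c i j z)
  let ?m = "scale c (monomial i j)"
  obtain p where p: "\<forall>\<phi>. splitting_rep 3 scale mul e \<phi> \<longrightarrow> mat3_minors (\<phi> z) = to_ac p"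
    using add by blast
  obtain t where t: "\<And>z \<phi>. splitting_rep 3 scale mul e \<phi> \<Longrightarrow> mat3_trace (\<phi> z) = to_ac (t z)"
    using trace_splitting_rational by metis
  show ?case
  proof (intro exI allI impI)
    fix \<phi> assume \<phi>: "splitting_rep 3 scale mul e \<phi>"
    have "mat3_minors (\<phi> (?m + z)) = mat3_minors (\<phi> ?m) + mat3_minors (\<phi> z)
        + mat3_trace (\<phi> ?m) * mat3_trace (\<phi> z) - mat3_trace (\<phi> (mul ?m z))"
      by (simp only: \<phi>_simps[OF \<phi>] mat3_minors_add smult_carrier_mat)
    also have "mat3_minors (\<phi> ?m) = to_ac (c\<^sup>2 * (if i = 0 \<and> j = 0 then 3 else 0))"
      using add(1,2) by (simp add: \<phi>_simps[OF \<phi>] mat3_minors_smult forms_splitting_monomial[OF \<phi>])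
    finally show "mat3_minors (\<phi> (?m + z)) =
        to_ac (c\<^sup>2 * (if i = 0 \<and> j = 0 then 3 else 0) + p + t ?m * t z - t (mul ?m z))"
      using p \<phi> by (simp only: t[OF \<phi>] to_ac_add to_ac_mult to_ac_diff)
  qed
qed

text \<open>The determinant is the remaining coefficient; three times it is a polynomial in the other two
coefficients of \<open>z\<close> and of its powers.\<close>
lemma reduced_char_poly_splitting:
  assumes \<phi>: "splitting_rep 3 scale mul e \<phi>"
  shows "map_poly to_ac (reduced_char_poly 3 scale mul e z) = char_poly (\<phi> z)"
proof -
  obtain t where t: "\<And>z \<phi>. splitting_rep 3 scale mul e \<phi> \<Longrightarrow> mat3_trace (\<phi> z) = to_ac (t z)"
    using trace_splitting_rational by metis
  obtain p where p: "\<And>z \<phi>. splitting_rep 3 scale mul e \<phi> \<Longrightarrow> mat3_minors (\<phi> z) = to_ac (p z)"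
    using minors_splitting_rational by metis
  define d where "d = (t (mul z (mul z z)) - t z * t (mul z z) + p z * t z) / 3"
  let ?P = "[: - d, p z, - t z, 1 :]"
  have P: "map_poly to_ac ?P = char_poly (\<phi> z)" if \<phi>: "splitting_rep 3 scale mul e \<phi>" for \<phi>
  proof -
    have "3 * det (\<phi> z) = to_ac (t (mul z (mul z z)) - t z * t (mul z z) + p z * t z)"
      unfolding three_det_mat3[OF \<phi>_simps(1)[OF \<phi>]]
      by (simp add: t[OF \<phi>] p[OF \<phi>] flip: \<phi>_simps[OF \<phi>])
    also have "t (mul z (mul z z)) - t z * t (mul z z) + p z * t z = 3 * d"
      using three_nonzero by (simp add: d_def)
    also have "to_ac (3 * d) = 3 * to_ac d" by simp
    finally have "3 * det (\<phi> z) = 3 * to_ac d" .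
    moreover have "(3 :: 'k alg_closure) \<noteq> 0"
      using three_nonzero by (metis to_ac_eq_0_iff to_ac_numeral)
    ultimately have "det (\<phi> z) = to_ac d" by simp
    then show ?thesis
      by (simp add: char_poly_mat3[OF \<phi>_simps(1)[OF \<phi>]] t[OF \<phi>] p[OF \<phi>] map_poly_pCons)
  qed
  have inj: "p = q" if "map_poly to_ac p = map_poly to_ac q" for p q :: "'k poly"
    using that by (auto simp: poly_eq_iff coeff_map_poly)
  have "\<forall>\<phi>. splitting_rep 3 scale mul e \<phi> \<longrightarrow>
      map_poly to_ac (reduced_char_poly 3 scale mul e z) = char_poly (\<phi> z)"
    unfolding reduced_char_poly_def
    by (rule theI[of _ ?P]) (use P splitting_exists in \<open>auto intro: inj\<close>)
  with \<phi> show ?thesis by blast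
qed

abbreviation "\<tau> \<equiv> char_tau scale mul e"
abbreviation "\<pi> \<equiv> char_pi scale mul e"

lemma
  assumes \<phi>: "splitting_rep 3 scale mul e \<phi>"
  shows to_ac_tau: "to_ac (\<tau> z) = mat3_trace (\<phi> z)"
    and to_ac_pi: "to_ac (\<pi> z) = mat3_minors (\<phi> z)"
proof -
  have "to_ac (poly.coeff (reduced_char_poly 3 scale mul e z) i) = poly.coeff (char_poly (\<phi> z)) i" for i
    by (simp add: coeff_map_poly flip: reduced_char_poly_splitting[OF \<phi>])
  then show "to_ac (\<tau> z) = mat3_trace (\<phi> z)" "to_ac (\<pi> z) = mat3_minors (\<phi> z)"
    by (simp_all add: char_tau_def char_pi_def char_poly_mat3[OF \<phi>_simps(1)[OF \<phi>]] numeral_2_eq_2)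
qed

text \<open>The values are determined by their images in the algebraic closure, where these are the identities
for matrices.\<close>
lemma tau_add: "\<tau> (z + w) = \<tau> z + \<tau> w"
  and tau_scale: "\<tau> (scale c z) = c * \<tau> z"
  and tau_e: "\<tau> e = 3"
  and tau_commute: "\<tau> (mul z w) = \<tau> (mul w z)"
  and pi_scale: "\<pi> (scale c z) = c\<^sup>2 * \<pi> z"
  and pi_add: "\<pi> (z + w) = \<pi> z + \<pi> w + \<tau> z * \<tau> w - \<tau> (mul z w)"
proof -
  obtain \<phi> where \<phi>: "splitting_rep 3 scale mul e \<phi>" using splitting_exists by blast
  note simps = to_ac_tau[OF \<phi>] to_ac_pi[OF \<phi>] \<phi>_simps[OF \<phi>] mat3_trace_add mat3_trace_smult
    mat3_trace_one mat3_minors_smult mat3_minors_add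
  show "\<tau> (z + w) = \<tau> z + \<tau> w"
    by (subst to_ac_eq_iff[symmetric]) (simp add: simps)
  show "\<tau> (scale c z) = c * \<tau> z"
    by (subst to_ac_eq_iff[symmetric]) (simp add: simps)
  show "\<tau> e = 3"
    by (subst to_ac_eq_iff[symmetric]) (simp add: simps)
  show "\<tau> (mul z w) = \<tau> (mul w z)"
    by (subst to_ac_eq_iff[symmetric]) (simp add: simps mat3_trace_commute[of "\<phi> z"])
  show "\<pi> (scale c z) = c\<^sup>2 * \<pi> z"
    by (subst to_ac_eq_iff[symmetric]) (simp add: simps)
  show "\<pi> (z + w) = \<pi> z + \<pi> w + \<tau> z * \<tau> w - \<tau> (mul z w)"
    by (subst to_ac_eq_iff[symmetric]) (simp add: simps)
qed

lemma tau_zero_eq [simp]: "\<tau> 0 = 0"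
  using tau_scale[of 0 0] by simp

lemma tau_monomial: "i < 3 \<Longrightarrow> j < 3 \<Longrightarrow> \<tau> (monomial i j) = (if i = 0 \<and> j = 0 then 3 else 0)"
  and pi_monomial: "i < 3 \<Longrightarrow> j < 3 \<Longrightarrow> \<pi> (monomial i j) = (if i = 0 \<and> j = 0 then 3 else 0)"
proof -
  obtain \<phi> where \<phi>: "splitting_rep 3 scale mul e \<phi>" using splitting_exists by blast
  assume "i < 3" "j < 3"
  then show "\<tau> (monomial i j) = (if i = 0 \<and> j = 0 then 3 else 0)"
    "\<pi> (monomial i j) = (if i = 0 \<and> j = 0 then 3 else 0)"
    by (subst to_ac_eq_iff[symmetric], simp add: to_ac_tau[OF \<phi>] to_ac_pi[OF \<phi>] forms_splitting_monomial[OF \<phi>])+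
qed

text \<open>Up to a nonzero scalar this is the coefficient of \<open>monomial i j\<close>: among the monomials, only the
inverse of \<open>monomial (3 - i) (3 - j)\<close>, up to scalars, has a product with it of nonzero trace.\<close>
definition coordinate :: "nat \<Rightarrow> nat \<Rightarrow> 's \<Rightarrow> 'k" where
  "coordinate i j z = \<tau> (mul z (monomial (3 - i) (3 - j)))"

lemma coordinate_add: "coordinate i j (z + w) = coordinate i j z + coordinate i j w"
  and coordinate_scale: "coordinate i j (scale c z) = c * coordinate i j z"
  by (simp_all add: coordinate_def mul_bilinear tau_add tau_scale)

lemma coordinate_monomial:
  assumes "i < 3" "j < 3" "k < 3" "l < 3"
  shows "coordinate i j (monomial k l) \<noteq> 0 \<longleftrightarrow> k = i \<and> l = j"
proof -
  \<comment> \<open>both sums lie between 1 and 5, where 3 is the only multiple of 3\<close>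
  have dvd: "(k + (3 - i)) mod 3 = 0 \<longleftrightarrow> k = i" "(l + (3 - j)) mod 3 = 0 \<longleftrightarrow> l = j"
    using assms by presburger+
  have "coordinate i j (monomial k l) = \<xi> ^ (l * (3 - i)) *
      (a ^ ((k + (3 - i)) div 3) * b ^ ((l + (3 - j)) div 3) *
        (if (k + (3 - i)) mod 3 = 0 \<and> (l + (3 - j)) mod 3 = 0 then 3 else 0))"
    unfolding coordinate_def monomial_mult
    by (subst monomial_mod) (simp add: tau_scale tau_monomial)
  then show ?thesis
    using nonzero \<xi>_nonzero three_nonzero by (auto simp: dvd)
qed

lemma inj_on_monomial: "inj_on (\<lambda>(i, j). monomial i j) ({..<3} \<times> {..<3})"
proof (rule inj_onI)
  fix p q assume pq: "p \<in> {..<3} \<times> {..<3}" "q \<in> {..<3} \<times> {..<3}"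
    and eq: "(case p of (i, j) \<Rightarrow> monomial i j) = (case q of (i, j) \<Rightarrow> monomial i j)"
  obtain i j k l where ij: "p = (i, j)" and kl: "q = (k, l)" by fastforce
  have "coordinate i j (monomial k l) \<noteq> 0"
    using pq eq coordinate_monomial[of i j i j] unfolding ij kl by auto
  then show "p = q"
    using pq coordinate_monomial[of i j k l] unfolding ij kl by auto
qed

lemma independent_monomials: "independent monomials"
  unfolding dependent_def
proof safe
  fix m assume "m \<in> monomials" and span: "m \<in> span (monomials - {m})"
  then obtain i j where ij: "i < 3" "j < 3" "m = monomial i j"
    by (auto simp: monomials_def)
  from span have "coordinate i j m = 0"
  proof (induction rule: span_induct_alt)
    case base
    then show ?case using coordinate_scale[of i j 0 0] by simp
  next
    case (step c z w)
    then have "coordinate i j z = 0"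
      using ij coordinate_monomial[OF ij(1,2)] by (auto simp: monomials_def)
    with step show ?case by (simp add: coordinate_add coordinate_scale)
  qed
  with ij coordinate_monomial[of i j i j] show False by simp
qed

text \<open>All coordinates of \<open>z\<close> are traces of multiples of \<open>z\<close>.\<close>
lemma tau_nondegenerate:
  assumes "\<And>w. \<tau> (mul z w) = 0"
  shows "z = 0"
proof -
  let ?I = "{..<3::nat} \<times> {..<3::nat}"
  have "finite monomials" by (simp add: monomials_def)
  then have "z \<in> range (\<lambda>u. \<Sum>m\<in>monomials. scale (u m) m)"
    using span_finite[of monomials] by (simp add: span_monomials)
  then obtain u where "z = (\<Sum>m\<in>monomials. scale (u m) m)"
    by blast
  then have z: "z = (\<Sum>m\<in>?I. scale (u (case_prod monomial m)) (case_prod monomial m))"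
    using inj_on_monomial by (simp add: monomials_def sum.reindex split_def)
  have coord_sum: "coordinate i j (\<Sum>m\<in>M. f m) = (\<Sum>m\<in>M. coordinate i j (f m))" for i j M and f :: "nat \<times> nat \<Rightarrow> 's"
    using coordinate_scale[of i j 0 0]
    by (induction M rule: infinite_finite_induct) (simp_all add: coordinate_add)
  have "u (monomial i j) = 0" if ij: "i < 3" "j < 3" for i j
  proof -
    have "0 = coordinate i j z" by (simp add: coordinate_def assms)
    also have "\<dots> = (\<Sum>m\<in>?I. if m = (i, j) then u (monomial i j) * coordinate i j (monomial i j) else 0)"
      unfolding z coord_sum coordinate_scale
      using coordinate_monomial[OF ij] by (intro sum.cong) auto
    also have "\<dots> = u (monomial i j) * coordinate i j (monomial i j)"
      using ij by (simp add: sum.delta)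
    finally show ?thesis using coordinate_monomial[of i j i j] ij by simp
  qed
  then show ?thesis by (subst z, intro sum.neutral) auto
qed

text \<open>Elements with the same image have the same traces of products with any third element, and the trace
form is nondegenerate.\<close>
lemma splitting_injective:
  assumes \<phi>: "splitting_rep 3 scale mul e \<phi>" and eq: "\<phi> z = \<phi> w"
  shows "z = w"
proof -
  have minus: "\<tau> (- z) = - \<tau> z" for z using tau_scale[of "-1" z] by simp
  have "\<tau> (mul (z - w) t) = 0" for t
  proof -
    have "to_ac (\<tau> (mul z t)) = to_ac (\<tau> (mul w t))"
      by (simp add: to_ac_tau[OF \<phi>] \<phi>_simps[OF \<phi>] eq)
    then show ?thesis
      using tau_add[of "mul z t" "- mul w t"] by (simp add: mul_bilinear minus)
  qed
  then have "z - w = 0" by (rule tau_nondegenerate)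
  then show ?thesis by simp
qed

lemma cayley_hamilton_polarized:
  assumes "\<tau> z = 0" "\<tau> w = 0"
  shows "mul z (mul z w) + mul z (mul w z) + mul w (mul z z) + scale (\<pi> z) w =
    scale (\<tau> (mul z w)) z + scale (\<tau> (mul z (mul z w))) e"
proof -
  obtain \<phi> where \<phi>: "splitting_rep 3 scale mul e \<phi>" using splitting_exists by blast
  have "mat3_trace (\<phi> z) = 0" "mat3_trace (\<phi> w) = 0"
    using assms by (simp_all flip: to_ac_tau[OF \<phi>])
  then have "\<phi> (mul z (mul z w) + mul z (mul w z) + mul w (mul z z) + scale (\<pi> z) w) =
      \<phi> (scale (\<tau> (mul z w)) z + scale (\<tau> (mul z (mul z w))) e)"
    using cayley_hamilton_mat3_polarized[of "\<phi> z" "\<phi> w"]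
    by (simp add: \<phi>_simps[OF \<phi>] to_ac_tau[OF \<phi>] to_ac_pi[OF \<phi>])
  then show ?thesis by (rule splitting_injective[OF \<phi>])
qed

end

section \<open>Symmetric composition algebras and Kaplansky's unital product\<close>

text \<open>A bilinear product with a quadratic form \<open>q\<close> for which \<open>q z\<close> times the identity is the composite,
in either order, of left and right multiplication by \<open>z\<close>.\<close>
locale symmetric_composition =
  fixes scale :: "'k::field \<Rightarrow> 's::ab_group_add \<Rightarrow> 's" and V :: "'s set"
    and prd :: "'s \<Rightarrow> 's \<Rightarrow> 's" and q :: "'s \<Rightarrow> 'k"
  assumes algebra: "algebra_on scale V prd"
    and quadratic: "quadratic_form_on scale V q"
    and nondegenerate: "nondegenerate_on V q"
    and flexible_left: "z \<in> V \<Longrightarrow> w \<in> V \<Longrightarrow> prd (prd z w) z = scale (q z) w"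
    and flexible_right: "z \<in> V \<Longrightarrow> w \<in> V \<Longrightarrow> prd z (prd w z) = scale (q z) w"
begin

sublocale vector_space scale
  using algebra by (simp add: algebra_on_def)

lemma V_subspace: "subspace V"
  using algebra by (simp add: algebra_on_def)

lemma V_closed: "z \<in> V \<Longrightarrow> w \<in> V \<Longrightarrow> prd z w \<in> V" "z \<in> V \<Longrightarrow> w \<in> V \<Longrightarrow> z + w \<in> V"
  "z \<in> V \<Longrightarrow> scale c z \<in> V" "0 \<in> V"
  using algebra V_subspace by (auto simp: algebra_on_def subspace_add subspace_scale subspace_0)

lemma prd_bilinear:
  "z \<in> V \<Longrightarrow> w \<in> V \<Longrightarrow> t \<in> V \<Longrightarrow> prd (z + w) t = prd z t + prd w t"
  "z \<in> V \<Longrightarrow> w \<in> V \<Longrightarrow> t \<in> V \<Longrightarrow> prd t (z + w) = prd t z + prd t w"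
  "z \<in> V \<Longrightarrow> w \<in> V \<Longrightarrow> prd (scale c z) w = scale c (prd z w)"
  "z \<in> V \<Longrightarrow> w \<in> V \<Longrightarrow> prd z (scale c w) = scale c (prd z w)"
  using algebra by (auto simp: algebra_on_def)

lemma q_scale: "z \<in> V \<Longrightarrow> q (scale c z) = c\<^sup>2 * q z"
  using quadratic by (simp add: quadratic_form_on_def)

text \<open>With \<open>p = zw\<close>, the element \<open>p(wp)\<close> is \<open>q(p) w\<close> by flexibility at \<open>p\<close>, and it is \<open>q(w) pz = q(w) q(z) w\<close>
by flexibility at \<open>w\<close> and then at \<open>z\<close>. Since only \<open>w\<close> is cancelled, this works in characteristic 2,
where linearizing \<open>q\<close> would lose a factor 2.\<close>
lemma composition:
  assumes "z \<in> V" "w \<in> V"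
  shows "q (prd z w) = q z * q w"
proof (cases "w = 0")
  case True
  have "q 0 = 0" using q_scale[of 0 0] V_closed by simp
  moreover have "prd z 0 = 0" using prd_bilinear(4)[of z 0 0] assms V_closed by simp
  ultimately show ?thesis using True by simp
next
  case False
  let ?p = "prd z w"
  have "scale (q ?p) w = prd ?p (prd w ?p)"
    by (intro flexible_right[symmetric] V_closed assms)
  also have "\<dots> = scale (q w) (prd ?p z)"
    using assms by (simp add: flexible_right V_closed prd_bilinear)
  also have "\<dots> = scale (q z * q w) w"
    using assms by (simp add: flexible_left mult.commute)
  finally show ?thesis using False by simp
qed

text \<open>Kaplansky's product: undoing right multiplication by \<open>v\<close> in the first factor and left
multiplication by \<open>v\<close> in the second one makes \<open>vv\<close> a unit.\<close>
definition kaplansky :: "'s \<Rightarrow> 's \<Rightarrow> 's \<Rightarrow> 's" where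
  "kaplansky v z w = prd (inv_into V (\<lambda>t. prd t v) z) (inv_into V (\<lambda>t. prd v t) w)"

context
  fixes v assumes v: "v \<in> V" "q v = 1"
begin

text \<open>Left and right multiplication by an element of norm 1 are inverse to each other.\<close>
lemma unit_norm_cancel: "z \<in> V \<Longrightarrow> prd (prd v z) v = z" "z \<in> V \<Longrightarrow> prd v (prd z v) = z"
  using v by (simp_all add: flexible_left flexible_right)

lemma bij_betw_right_mult: "bij_betw (\<lambda>z. prd z v) V V"
  and bij_betw_left_mult: "bij_betw (\<lambda>z. prd v z) V V"
  by (rule bij_betw_byWitness[where f' = "\<lambda>z. prd v z"],
      use v in \<open>auto simp: unit_norm_cancel V_closed\<close>)
    (rule bij_betw_byWitness[where f' = "\<lambda>z. prd z v"],
      use v in \<open>auto simp: unit_norm_cancel V_closed\<close>)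

lemma kaplansky_eq: "z \<in> V \<Longrightarrow> w \<in> V \<Longrightarrow> kaplansky v z w = prd (prd v z) (prd w v)"
proof -
  assume "z \<in> V" "w \<in> V"
  then have "inv_into V (\<lambda>t. prd t v) z = prd v z" "inv_into V (\<lambda>t. prd v t) w = prd w v"
    using v bij_betw_right_mult bij_betw_left_mult
    by (auto intro!: inv_into_f_eq simp: bij_betw_def unit_norm_cancel V_closed)
  then show ?thesis by (simp add: kaplansky_def)
qed

text \<open>The unit is \<open>vv\<close>. The form is multiplicative for the new product because both \<open>z \<mapsto> vz\<close> and
\<open>w \<mapsto> wv\<close> preserve it.\<close>
lemma hurwitz_kaplansky: "hurwitz_algebra_on scale V (kaplansky v) q"
  unfolding hurwitz_algebra_on_def
proof (intro conjI quadratic nondegenerate ballI)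
  show "algebra_on scale V (kaplansky v)"
    unfolding algebra_on_def
    using v vector_space_axioms V_subspace by (simp add: kaplansky_eq V_closed prd_bilinear)
  have "prd v v \<in> V" "prd v (prd v v) = v" "prd (prd v v) v = v"
    using v by (simp_all add: V_closed unit_norm_cancel)
  then show "\<exists>i\<in>V. \<forall>z\<in>V. kaplansky v i z = z \<and> kaplansky v z i = z"
    by (intro bexI[of _ "prd v v"]) (simp_all add: kaplansky_eq unit_norm_cancel)
  fix z w assume "z \<in> V" "w \<in> V"
  then show "q (kaplansky v z w) = q z * q w"
    using v by (simp add: kaplansky_eq composition V_closed)
qed

end

end

section \<open>The Okubo product on the trace zero space\<close>

context cubic_symbol_algebra
begin

abbreviation "T0 \<equiv> tau_zero scale mul e"
abbreviation circ_product (infixl "\<odot>" 70) where "z \<odot> w \<equiv> circ scale mul e \<xi> z w"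

lemma tau_zero_iff: "z \<in> T0 \<longleftrightarrow> \<tau> z = 0"
  by (simp add: tau_zero_def)

lemma subspace_tau_zero: "subspace T0"
  by (rule subspaceI) (simp_all add: tau_zero_iff tau_add tau_scale)

lemma tau_diff: "\<tau> (z - w) = \<tau> z - \<tau> w"
  using tau_add[of "z - w" w] by simp

lemma tau_circ: "\<tau> (z \<odot> w) = 0"
proof -
  have "\<tau> (z \<odot> w) = \<xi> * \<tau> (mul z w) - \<xi>\<^sup>2 * \<tau> (mul z w) - (2 * \<xi> + 1) / 3 * \<tau> (mul z w) * 3"
    by (simp only: circ_def tau_diff tau_scale tau_e tau_commute[of w z])
  also have "\<dots> = (\<xi> - \<xi>\<^sup>2 - (2 * \<xi> + 1)) * \<tau> (mul z w)"
    using three_nonzero by (simp add: field_simps)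
  also have "\<dots> = 0" by (simp add: \<xi>_square)
  finally show ?thesis .
qed

lemma tau_cyclic: "\<tau> (mul z (mul w z)) = \<tau> (mul z (mul z w))" "\<tau> (mul w (mul z z)) = \<tau> (mul z (mul z w))"
proof -
  show "\<tau> (mul z (mul w z)) = \<tau> (mul z (mul z w))"
    using tau_commute[of z "mul z w"] by (simp add: mul_assoc)
  show "\<tau> (mul w (mul z z)) = \<tau> (mul z (mul z w))"
    using tau_commute[of w "mul z z"] by (simp add: mul_assoc)
qed

text \<open>Expanding either side gives \<open>(\<xi>\<^sup>2 + \<xi>) zwz - wzz - zzw\<close> plus multiples of \<open>z\<close> and of the unit. As
\<open>\<xi>\<^sup>2 + \<xi> = -1\<close>, the cubic part is minus the left-hand side of the polarized Cayley-Hamilton identity.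
The coefficient \<open>\<kappa> = (2\<xi> + 1)/3\<close> in the product is the one that makes the lower terms cancel too,
because \<open>(\<xi> - \<xi>\<^sup>2) \<kappa> = -1\<close>.\<close>
lemma
  assumes z: "\<tau> z = 0" and w: "\<tau> w = 0"
  shows circ_flexible_left: "(z \<odot> w) \<odot> z = scale (\<pi> z) w"
    and circ_flexible_right: "z \<odot> (w \<odot> z) = scale (\<pi> z) w"
proof -
  define \<kappa> where "\<kappa> = (2 * \<xi> + 1) / 3"
  have circ: "z \<odot> w = scale \<xi> (mul z w) - scale (\<xi>\<^sup>2) (mul w z) - scale (\<kappa> * \<tau> (mul z w)) e" for z w
    by (simp add: circ_def \<kappa>_def)
  define A where "A = mul z (mul z w)"
  define B where "B = mul z (mul w z)"
  define C where "C = mul w (mul z z)"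
  define s where "s = \<tau> (mul z w)"
  define t where "t = \<tau> A"
  have s: "\<tau> (mul z w) = s" "\<tau> (mul w z) = s" and t: "\<tau> A = t" "\<tau> B = t" "\<tau> C = t"
    by (simp_all add: s_def t_def A_def B_def C_def tau_cyclic(1)[of z w] tau_cyclic(2)[of w z] tau_commute[of w z])
  note fold = A_def[symmetric] B_def[symmetric] C_def[symmetric]
  have \<kappa>: "(\<xi> - \<xi>\<^sup>2) * \<kappa> = -1"
  proof -
    have "(\<xi> - \<xi>\<^sup>2) * (2 * \<xi> + 1) = (\<xi>\<^sup>2 + \<xi>) - 2 * \<xi> ^ 3"
      by (simp add: algebra_simps power2_eq_square power3_eq_cube)
    also have "\<dots> = -3" using \<xi>_square \<xi>_cube by simp
    finally have "(\<xi> - \<xi>\<^sup>2) * (2 * \<xi> + 1) = -3" .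
    then show ?thesis using three_nonzero by (simp add: \<kappa>_def)
  qed
  have cubes: "\<xi> * \<xi>\<^sup>2 = 1" "\<xi>\<^sup>2 * \<xi> = 1" "\<xi>\<^sup>2 * \<xi>\<^sup>2 = \<xi>"
    using \<xi>_cube by (simp_all add: power2_eq_square power3_eq_cube mult.assoc)
  have sum: "\<xi> * \<xi> + \<xi>\<^sup>2 * \<xi>\<^sup>2 = -1"
    by (subst cubes(3)) (simp add: \<xi>_square flip: power2_eq_square)
  have CH: "A + B + C + scale (\<pi> z) w = scale s z + scale t e"
    using cayley_hamilton_polarized[OF z w] by (simp add: A_def B_def C_def s_def t_def)
  have combination: "scale (\<xi> * \<xi> + \<xi>\<^sup>2 * \<xi>\<^sup>2) B - scale (\<xi> * \<xi>\<^sup>2) C - scale (\<xi>\<^sup>2 * \<xi>) A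
      - scale ((\<xi> - \<xi>\<^sup>2) * \<kappa> * s) z - scale ((\<xi> - \<xi>\<^sup>2) * \<kappa> * t) e = scale (\<pi> z) w"
  proof -
    have "scale (\<pi> z) w = scale s z + scale t e - (A + B + C)"
      using CH by (metis add_diff_cancel_left')
    then show ?thesis by (simp only: sum cubes(1,2) \<kappa>) simp
  qed
  have trace: "\<tau> (mul (z \<odot> w) z) = (\<xi> - \<xi>\<^sup>2) * t" "\<tau> (mul z (w \<odot> z)) = (\<xi> - \<xi>\<^sup>2) * t"
    by (simp_all add: circ mul_bilinear mul_assoc fold t tau_diff tau_scale z left_diff_distrib)
  have "(z \<odot> w) \<odot> z = scale (\<xi> * \<xi> + \<xi>\<^sup>2 * \<xi>\<^sup>2) B - scale (\<xi> * \<xi>\<^sup>2) C - scale (\<xi>\<^sup>2 * \<xi>) A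
      - scale ((\<xi> - \<xi>\<^sup>2) * \<kappa> * s) z - scale ((\<xi> - \<xi>\<^sup>2) * \<kappa> * t) e"
    unfolding circ[of "z \<odot> w" z] trace unfolding circ[of z w]
    by (simp add: mul_bilinear mul_assoc fold s algebra_simps)
  then show "(z \<odot> w) \<odot> z = scale (\<pi> z) w" by (simp only: combination)
  have "z \<odot> (w \<odot> z) = scale (\<xi> * \<xi> + \<xi>\<^sup>2 * \<xi>\<^sup>2) B - scale (\<xi> * \<xi>\<^sup>2) C - scale (\<xi>\<^sup>2 * \<xi>) A
      - scale ((\<xi> - \<xi>\<^sup>2) * \<kappa> * s) z - scale ((\<xi> - \<xi>\<^sup>2) * \<kappa> * t) e"
    unfolding circ[of z "w \<odot> z"] trace unfolding circ[of w z]
    by (simp add: mul_bilinear mul_assoc fold s algebra_simps)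
  then show "z \<odot> (w \<odot> z) = scale (\<pi> z) w" by (simp only: combination)
qed

lemma algebra_on_circ: "algebra_on scale T0 (\<odot>)"
  unfolding algebra_on_def
  using vector_space_axioms subspace_tau_zero
  by (auto simp: tau_zero_iff tau_circ)
    (simp_all add: circ_def mul_bilinear tau_add tau_scale algebra_simps scale_left_distrib)

lemma polar_form_pi: "z \<in> T0 \<Longrightarrow> polar_form \<pi> z w = - \<tau> (mul z w)"
  by (simp add: polar_form_def pi_add tau_zero_iff)

lemma quadratic_form_on_pi: "quadratic_form_on scale T0 \<pi>"
  using subspace_tau_zero
  by (simp add: quadratic_form_on_def pi_scale polar_form_pi mul_bilinear tau_add tau_scale
      subspace_add subspace_scale)

text \<open>The polar form of \<open>\<pi>\<close> on the trace zero space is minus the trace form. An element orthogonal to this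
space is orthogonal to the unit as well, since it has trace zero itself, and the two span the algebra
because 3 is invertible.\<close>
lemma nondegenerate_on_pi: "nondegenerate_on T0 \<pi>"
  unfolding nondegenerate_on_def
proof (intro ballI impI)
  fix z assume z: "z \<in> T0" and orth: "\<forall>w\<in>T0. polar_form \<pi> z w = 0"
  show "z = 0"
  proof (rule tau_nondegenerate)
    fix w
    \<comment> \<open>the trace zero part of \<open>w\<close>\<close>
    let ?w = "w - scale (\<tau> w / 3) e"
    have "?w \<in> T0" using three_nonzero by (simp add: tau_zero_iff tau_diff tau_scale tau_e)
    with orth z have "\<tau> (mul z ?w) = 0" by (simp add: polar_form_pi)
    with z show "\<tau> (mul z w) = 0"
      by (simp add: mul_bilinear tau_diff tau_scale tau_zero_iff)
  qed
qed

sublocale circ: symmetric_composition scale T0 "(\<odot>)" \<pi>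
  by unfold_locales
    (simp_all add: algebra_on_circ quadratic_form_on_pi nondegenerate_on_pi tau_zero_iff
      circ_flexible_left circ_flexible_right)

text \<open>The monomials other than the unit have trace zero, and the unit has trace \<open>3 \<noteq> 0\<close>.\<close>
lemma dim_tau_zero: "dim T0 = 8"
proof -
  let ?B = "monomials - {e}"
  have e: "e \<in> monomials"
    by (auto simp: monomials_def intro!: image_eqI[of _ _ "(0, 0)"])
  have "\<tau> m = 0" if "m \<in> ?B" for m
    using that by (auto simp: monomials_def tau_monomial split: if_splits)
  then have "?B \<subseteq> T0" by (intro subsetI) (simp only: tau_zero_iff)
  then have sub: "span ?B \<subseteq> T0" by (rule span_minimal[OF _ subspace_tau_zero])
  have "z \<in> span ?B" if "z \<in> T0" for z
  proof -
    have "z \<in> span (insert e ?B)" using e by (simp add: insert_absorb span_monomials)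
    then obtain k where k: "z - scale k e \<in> span ?B" unfolding span_insert by blast
    then have "\<tau> (z - scale k e) = 0" using sub by (auto simp: tau_zero_iff)
    then have "k = 0" using that three_nonzero by (simp add: tau_diff tau_scale tau_e tau_zero_iff)
    with k show ?thesis by simp
  qed
  with sub have "span ?B = T0" by blast
  moreover have "independent ?B"
    by (rule independent_mono[OF independent_monomials]) blast
  moreover have "card ?B = 8"
    using e inj_on_monomial by (simp add: monomials_def card_image card_cartesian_product)
  ultimately show ?thesis
    using subspace_tau_zero by (metis dim_eq_card span_eq_iff)
qed

text \<open>The generator \<open>x\<close>, with characteristic polynomial \<open>X\<^sup>3 - a\<close>, is isotropic.\<close>
lemma not_division_norm: "\<not> division_norm_on T0 \<pi>"
proof -
  have "monomial 1 0 \<noteq> 0"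
    using coordinate_monomial[of 1 0 1 0] coordinate_scale[of 1 0 0 0] by auto
  moreover have "\<tau> (monomial 1 0) = 0" "\<pi> (monomial 1 0) = 0"
    using tau_monomial[of 1 0] pi_monomial[of 1 0] by simp_all
  ultimately show ?thesis
    by (auto simp: division_norm_on_def tau_zero_iff)
qed

lemma nabla_eq_kaplansky: "nabla scale mul e \<xi> v = circ.kaplansky v"
  by (simp add: fun_eq_iff nabla_def circ.kaplansky_def)

lemma octonion_nabla:
  assumes "v \<in> T0" "\<pi> v = 1"
  shows "octonion_algebra_on scale T0 (nabla scale mul e \<xi> v) \<pi>"
  using circ.hurwitz_kaplansky[OF assms]
  by (simp add: octonion_algebra_on_def nabla_eq_kaplansky dim_tau_zero)

lemma unit_norm_normalized_square:
  assumes "u \<in> T0" "\<pi> u \<noteq> 0"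
  shows "scale (1 / \<pi> u) (u \<odot> u) \<in> T0" "\<pi> (scale (1 / \<pi> u) (u \<odot> u)) = 1"
  using assms by (simp_all add: circ.V_closed circ.q_scale circ.composition power2_eq_square)

end

theorem theorem3p5:
  fixes scale :: "'k::field \<Rightarrow> 's::ab_group_add \<Rightarrow> 's"
    and mul :: "'s \<Rightarrow> 's \<Rightarrow> 's" and e :: 's
    and \<xi> a b :: 'k and u v :: 's
  assumes "CHAR('k) \<noteq> 3"
    and "primitive_root_of_unity 3 \<xi>"
    and "a \<noteq> 0" and "b \<noteq> 0"
    and "symbol_algebra scale mul e 3 \<xi> a b"
    and "u \<in> tau_zero scale mul e"
    and "char_pi scale mul e u \<noteq> 0"
    and "v = scale (1 / char_pi scale mul e u) (circ scale mul e \<xi> u u)"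
  shows "v \<in> tau_zero scale mul e \<and>
    bij_betw (\<lambda>z. circ scale mul e \<xi> z v) (tau_zero scale mul e) (tau_zero scale mul e) \<and>
    bij_betw (\<lambda>z. circ scale mul e \<xi> v z) (tau_zero scale mul e) (tau_zero scale mul e) \<and>
    (\<exists>N. octonion_algebra_on scale (tau_zero scale mul e) (nabla scale mul e \<xi> v) N \<and>
         \<not> division_norm_on (tau_zero scale mul e) N)"
proof -
  note symbol = assms(5)
  obtain x y where "surj (eval_free scale mul e x y)" "symbol_relations scale mul e 3 \<xi> a b x y"
    using symbol_algebra_generators[OF symbol] .
  with symbol splitting_rep_exists[OF symbol]
  interpret cubic_symbol_algebra scale mul e \<xi> a b x y
    by unfold_locales (auto simp: symbol_algebra_def)
  have v: "v \<in> tau_zero scale mul e" "char_pi scale mul e v = 1"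
    using unit_norm_normalized_square assms by simp_all
  show ?thesis
    using v circ.bij_betw_right_mult[OF v] circ.bij_betw_left_mult[OF v]
      octonion_nabla[OF v] not_division_norm by blast
qed

end
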